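(* Let $X$ be a smooth complex projective variety of dimension $n$ with a linear system $E$ giving a Kodaira embedding $X\hookrightarrow\mathbb{P}(E^* )$, and let $H$ be a Hermitian product on $E^*$. Choose a point $p\in X$, a coordinate system $(u_1,\dots,u_n)$ at $p$, a section $\tau\in E$ with $\tau(p)\ne0$, and the basis $\{\eta_1,\dots,\eta_r\}$ of $E$, vectors $\beta_j$ and weight $\gamma$ as described in the context, and assume that the differences of elements of the value set $\mathcal{A}$ generate the lattice $\mathbb{Z}^n$. Let $\pi:\mathcal{X}\to\mathbb{C}$ be the family associated to $X,p,(u_i),\gamma$. Then the holomorphic map $F:\mathcal{X}\to\mathbb{CP}^{r-1}\times\mathbb{C}$, $F(\tilde x)=((\tilde f_1(\tilde x):\cdots:\tilde f_r(\tilde x)),\pi(\tilde x))$, is an immersion, i.e. its derivative at every point has maximum rank $n+1$.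
   Context: $\mathbb{N}$ denotes the positive integers, $\mathbb{C}^*=\mathbb{C}\setminus\{0\}$, and $u^\alpha=u_1^{\alpha_1}\cdots u_n^{\alpha_n}$. Valuation and basis. $E$ is a finite dimensional space (dimension $r$) of holomorphic sections of a line bundle on $X$ whose Kodaira map $X\to\mathbb{P}(E^* )$ is an embedding. A coordinate system $(u_1,\dots,u_n)$ at $p$ consists of rational functions regular at $p$ with $u_i(p)=0$ and $du_1,\dots,du_n$ linearly independent at $p$. Fix a total order on $\mathbb{Z}^n$ respecting addition (e.g. lexicographic) for which every nonempty subset of $\mathbb{Z}^n_{\ge0}$ has a least element. For $0\ne f\in\mathcal{O}_{X,p}$ with $f=\sum_{\alpha\in\mathbb{Z}_{\ge0}^n}c_\alpha u^\alpha$ let $v(f)=\min\{\alpha\mid c_\alpha\ne0\}$, extended to $\mathbb{C}(X)\setminus\{0\}$ by $v(f/g)=v(f)-v(g)$. Put $\mathcal{A}=\{v(\sigma/\tau)\mid0\ne\sigma\in E\}$; it is finite with $|\mathcal{A}|=r$. Let $\{\eta_1,\dots,\eta_r\}$ be a basis of $E$ whose dual basis is orthonormal in $(E^*,H)$ and with $\{v(\eta_1/\tau),\dots,v(\eta_r/\tau)\}=\mathcal{A}$ (such a basis exists). Put $f_j=\eta_j/\tau=\sum_\alpha c_{\alpha,j}u^\alpha$ near $p$, $\beta_j=v(f_j)$, $\mathrm{supp}(f_j)=\{\alpha\mid c_{\alpha,j}\neq0\}$. Let $\gamma\in\mathbb{N}^n$ be such that for each $j$, $\beta_j$ is the unique point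 of $\mathrm{supp}(f_j)$ at which $\min\{\gamma\cdot\alpha\mid\alpha\in\mathrm{supp}(f_j)\}$ is attained. Family. Let $U\subset X$ be an open neighborhood of $p$ (classical topology) on which $(u_1,\dots,u_n)$ is a biholomorphism onto an open subset of $\mathbb{C}^n$. Let $\tilde\phi:U\times\mathbb{C}^*\to\mathbb{C}^{n+1}$, $\tilde\phi(x,t)=(t^{-\gamma_1}u_1(x),\dots,t^{-\gamma_n}u_n(x),t)$, and $\tilde U=\tilde\phi(U\times\mathbb{C}^* )\cup((\mathbb{C}^* )^n\times\{0\})$, an open subset of $\mathbb{C}^{n+1}$ with coordinates $(\tilde u,t)$. The complex manifold $\mathcal{X}$ is obtained by gluing $X\times\mathbb{C}^*$ and $\tilde U$ along $U\times\mathbb{C}^*\cong\tilde\phi(U\times\mathbb{C}^* )$ via $\tilde\phi$, and $\pi:\mathcal{X}\to\mathbb{C}$ is $(x,t)\mapsto t$, $(\tilde u,t)\mapsto t$. The map $F$. On $X\times\mathbb{C}^*$, $\tilde f_j(x,t)=t^{-\gamma\cdot\beta_j}f_j(x)$; near the zero fiber $(\mathbb{C}^* )^n\times\{0\}$, $\tilde f_j$ extends holomorphically, given by the convergent power series $\tilde f_j(\tilde u,t)=\sum_\alpha c_{\alpha,j}\tilde u^\alpha t^{\gamma\cdot\alpha-\gamma\cdot\beta_j}$. On the locus $\tau=0$ in $X\times\mathbb{C}^*$, $F$ is defined by holomorphic extension, i.e. $F(x,t)=((t^{-\gamma\cdot\beta_1}\eta_1(x):\cdots:t^{-\gamma\cdot\beta_r}\eta_r(x)),t)$.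 *)

theory Defs
  imports "HOL-Analysis.Analysis" "HOL-Library.Function_Algebras"
begin

section \<open>Holomorphic maps and immersions in several variables\<close>

text \<open>
  Differentiability with a complex linear derivative. The Jacobian matrix is a complex matrix, so
  complex linearity is built in and the rank of the derivative is the library's \<open>rank\<close>.
\<close>

definition holo_map :: "(complex^'k \<Rightarrow> complex^'l) \<Rightarrow> (complex^'k) set \<Rightarrow> bool" where
  "holo_map f S \<longleftrightarrow>
     (\<forall>x\<in>S. \<exists>A :: complex^'k^'l. (f has_derivative (\<lambda>h. A *v h)) (at x))"

definition holo_scalar :: "(complex^'k \<Rightarrow> complex) \<Rightarrow> (complex^'k) set \<Rightarrow> bool" where
  "holo_scalar g S \<longleftrightarrow>
     (\<forall>x\<in>S. \<exists>a :: complex^'k. (g has_derivative (\<lambda>h. \<Sum>i\<in>UNIV. a$i * h$i)) (at x))"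

type_synonym ('k, 'a) params = "((complex^'k) set \<times> (complex^'k \<Rightarrow> 'a)) set"
type_synonym ('b, 'l) charts = "('b set \<times> ('b \<Rightarrow> complex^'l)) set"

text \<open>
  The source manifold is given by the inverses \<open>(W, \<psi>)\<close> of its charts (\<open>\<psi>\<close> maps the open set
  \<open>W \<subseteq> \<complex>\<^sup>k\<close> bijectively onto the chart domain), the target by its charts \<open>(V, \<kappa>)\<close>. A chart of a
  projective space may take values in an affine hyperplane of \<open>\<complex>\<^sup>l\<close>; this does not affect ranks.
  The predicate says that \<open>f\<close> is holomorphic near \<open>x\<close> and that its derivative at \<open>x\<close> has rank \<open>k\<close>.
\<close>

definition holo_with_rank_at ::
  "('k::finite, 'a) params \<Rightarrow> ('b, 'l::finite) charts \<Rightarrow>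
   ('a \<Rightarrow> 'b) \<Rightarrow> 'a \<Rightarrow> nat \<Rightarrow> bool" where
  "holo_with_rank_at Par Ch f x k \<longleftrightarrow>
     (\<exists>(W, \<psi>) \<in> Par. \<exists>(V, \<kappa>) \<in> Ch. \<exists>y\<in>W. \<exists>O'. \<exists>A :: complex^'k^'l.
        \<psi> y = x \<and> open O' \<and> y \<in> O' \<and> O' \<subseteq> W \<and> (f \<circ> \<psi>) ` O' \<subseteq> V \<and>
        holo_map (\<kappa> \<circ> f \<circ> \<psi>) O' \<and>
        ((\<kappa> \<circ> f \<circ> \<psi>) has_derivative (\<lambda>h. A *v h)) (at y) \<and> rank A = k)"

text \<open>For an immersion \<open>k\<close> is the dimension of the source, which is the number of coordinates.\<close>

definition holomorphic_immersion ::
  "('k::finite, 'a) params \<Rightarrow> ('b, 'l::finite) charts \<Rightarrow>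
   'a set \<Rightarrow> ('a \<Rightarrow> 'b) \<Rightarrow> bool" where
  "holomorphic_immersion Par Ch M f \<longleftrightarrow>
     (\<forall>x\<in>M. holo_with_rank_at Par Ch f x CARD('k))"

text \<open>The topology on the target defined by its charts.\<close>

definition chart_open :: "('b, 'l::finite) charts \<Rightarrow> 'b set \<Rightarrow> bool" where
  "chart_open Ch Q \<longleftrightarrow>
     Q \<subseteq> (\<Union>(V, \<kappa>)\<in>Ch. V) \<and>
     (\<forall>(V, \<kappa>) \<in> Ch. openin (top_of_set (\<kappa> ` V)) (\<kappa> ` (Q \<inter> V)))"


section \<open>Complex projective space\<close>

quotient_type (overloaded) 'm cproj = "complex^('m::finite)" /
    partial: "\<lambda>v w. v \<noteq> 0 \<and> w \<noteq> 0 \<and> (\<exists>c. c \<noteq> 0 \<and> w = c *s v)"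
  morphisms hcoord pt
proof (rule part_equivpI)
  show "\<exists>v::complex^'m. v \<noteq> 0 \<and> v \<noteq> 0 \<and> (\<exists>c. c \<noteq> 0 \<and> v = c *s v)"
    by (rule exI[of _ "1"]) (auto intro!: exI[of _ 1] simp: vec_eq_iff)
  show "symp (\<lambda>v w::complex^'m. v \<noteq> 0 \<and> w \<noteq> 0 \<and> (\<exists>c. c \<noteq> 0 \<and> w = c *s v))"
  proof (rule sympI)
    fix v w :: "complex^'m"
    assume "v \<noteq> 0 \<and> w \<noteq> 0 \<and> (\<exists>c. c \<noteq> 0 \<and> w = c *s v)"
    then obtain c where "v \<noteq> 0" "w \<noteq> 0" "c \<noteq> 0" "w = c *s v" by blast
    then have "v = inverse c *s w" by (simp add: vec_eq_iff)
    then show "w \<noteq> 0 \<and> v \<noteq> 0 \<and> (\<exists>c. c \<noteq> 0 \<and> v = c *s w)"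
      using \<open>v \<noteq> 0\<close> \<open>w \<noteq> 0\<close> \<open>c \<noteq> 0\<close> by (metis inverse_nonzero_iff_nonzero)
  qed
  show "transp (\<lambda>v w::complex^'m. v \<noteq> 0 \<and> w \<noteq> 0 \<and> (\<exists>c. c \<noteq> 0 \<and> w = c *s v))"
    by (rule transpI) (metis mult_eq_0_iff vector_smult_assoc)
qed

text \<open>\<open>hcoord x\<close> is some choice of homogeneous coordinates of \<open>x\<close>.\<close>

instantiation cproj :: (finite) topological_space
begin

definition open_cproj :: "'a cproj set \<Rightarrow> bool" where
  "open_cproj Q \<longleftrightarrow> open {v. v \<noteq> 0 \<and> pt v \<in> Q}"

instance
proof
  have "{v::complex^'a. v \<noteq> 0 \<and> pt v \<in> UNIV} = - {0}" by auto
  then show "open (UNIV :: 'a cproj set)"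
    unfolding open_cproj_def by (simp only: open_Compl[OF closed_singleton])
next
  fix S T :: "'a cproj set" assume "open S" "open T"
  moreover have "{v. v \<noteq> 0 \<and> pt v \<in> S \<inter> T} = {v. v \<noteq> 0 \<and> pt v \<in> S} \<inter> {v. v \<noteq> 0 \<and> pt v \<in> T}"
    by auto
  ultimately show "open (S \<inter> T)" unfolding open_cproj_def by (simp only: open_Int)
next
  fix K :: "'a cproj set set" assume "\<forall>S\<in>K. open S"
  moreover have "{v. v \<noteq> 0 \<and> pt v \<in> \<Union>K} = (\<Union>S\<in>K. {v. v \<noteq> 0 \<and> pt v \<in> S})" by auto
  ultimately show "open (\<Union>K)" unfolding open_cproj_def by (simp only: open_UN)
qed

end

definition affine_coords :: "'m::finite \<Rightarrow> 'm cproj \<Rightarrow> complex^'m" where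
  "affine_coords i x = (\<chi> j. hcoord x $ j / hcoord x $ i)"

definition cproj_charts :: "('m::finite cproj, 'm) charts" where
  "cproj_charts = {({x. hcoord x $ i \<noteq> 0}, affine_coords i) | i. True}"


section \<open>Smooth projective varieties\<close>

definition homogeneous_poly :: "nat \<Rightarrow> (complex^'m::finite \<Rightarrow> complex) \<Rightarrow> bool" where
  "homogeneous_poly d P \<longleftrightarrow>
     (\<exists>a :: ('m \<Rightarrow> nat) \<Rightarrow> complex.
        P = (\<lambda>z. \<Sum>\<alpha> | (\<Sum>i\<in>UNIV. \<alpha> i) = d. a \<alpha> * (\<Prod>i\<in>UNIV. z$i ^ \<alpha> i)))"

definition zariski_closed :: "'m::finite cproj set \<Rightarrow> bool" where
  "zariski_closed X \<longleftrightarrow>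
     (\<exists>S. (\<forall>P\<in>S. \<exists>d. homogeneous_poly d P) \<and> X = {x. \<forall>P\<in>S. P (hcoord x) = 0})"

definition projective_variety :: "'m::finite cproj set \<Rightarrow> bool" where
  "projective_variety X \<longleftrightarrow> zariski_closed X \<and> X \<noteq> {} \<and>
     (\<forall>Y Z. zariski_closed Y \<and> zariski_closed Z \<and> X \<subseteq> Y \<union> Z \<longrightarrow> X \<subseteq> Y \<or> X \<subseteq> Z)"

definition variety_chain :: "'m::finite cproj set \<Rightarrow> nat \<Rightarrow> bool" where
  "variety_chain X k \<longleftrightarrow>
     (\<exists>Y :: nat \<Rightarrow> 'm cproj set. (\<forall>i\<le>k. projective_variety (Y i) \<and> Y i \<subseteq> X) \<and>
        (\<forall>i<k. Y i \<subset> Y (Suc i)))"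

definition variety_dim :: "'m::finite cproj set \<Rightarrow> nat \<Rightarrow> bool" where
  "variety_dim X n \<longleftrightarrow> variety_chain X n \<and> \<not> variety_chain X (Suc n)"

text \<open>
  The Zariski tangent space of the affine cone over \<open>X\<close> at a representative of \<open>x\<close>; its dimension
  exceeds that of the tangent space of \<open>X\<close> at \<open>x\<close> by one.
\<close>

definition cone_tangent_space :: "'m::finite cproj set \<Rightarrow> 'm cproj \<Rightarrow> (complex^'m) set" where
  "cone_tangent_space X x =
     {w. \<forall>d P. homogeneous_poly d P \<and> (\<forall>y\<in>X. P (hcoord y) = 0) \<longrightarrow>
           frechet_derivative P (at (hcoord x)) w = 0}"

definition smooth_projective_variety :: "'m::finite cproj set \<Rightarrow> nat \<Rightarrow> bool" where
  "smooth_projective_variety X n \<longleftrightarrow> projective_variety X \<and> variety_dim X n \<and>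
     (\<forall>x\<in>X. vec.dim (cone_tangent_space X x) = n + 1)"

text \<open>
  A rational function regular at \<open>x\<close>: it agrees with a fraction of homogeneous polynomials of equal
  degree, wherever the denominator does not vanish, and the denominator does not vanish at \<open>x\<close>.
\<close>

definition rational_regular_at ::
  "'m::finite cproj set \<Rightarrow> ('m cproj \<Rightarrow> complex) \<Rightarrow> 'm cproj \<Rightarrow> bool" where
  "rational_regular_at X f x \<longleftrightarrow>
     (\<exists>d P Q. homogeneous_poly d P \<and> homogeneous_poly d Q \<and> Q (hcoord x) \<noteq> 0 \<and>
        (\<forall>y\<in>X. Q (hcoord y) \<noteq> 0 \<longrightarrow> f y = P (hcoord y) / Q (hcoord y)))"

text \<open>
  Inverses of the holomorphic charts of \<open>X\<close> as a complex submanifold of projective space (classical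
  topology): injective holomorphic immersions that are open maps into \<open>X\<close>.
\<close>

definition local_params ::
  "'m::finite cproj set \<Rightarrow> ('n::finite, 'm cproj) params" where
  "local_params X = {(W, \<psi>). open W \<and> inj_on \<psi> W \<and>
     (\<forall>V. open V \<and> V \<subseteq> W \<longrightarrow> openin (top_of_set X) (\<psi> ` V)) \<and>
     holomorphic_immersion {(W, id)} cproj_charts W \<psi>}"

definition holo_on_variety ::
  "('n::finite, 'm::finite cproj) params \<Rightarrow>
   'm cproj set \<Rightarrow> ('m cproj \<Rightarrow> complex) \<Rightarrow> bool" where
  "holo_on_variety Par Q g \<longleftrightarrow> (\<forall>(W, \<psi>) \<in> Par. holo_scalar (g \<circ> \<psi>) {y\<in>W. \<psi> y \<in> Q})"


section \<open>Line bundles, sections and the Kodaira map\<close>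

text \<open>
  A holomorphic line bundle on \<open>X\<close> given by an open cover \<open>T\<close> of trivialising sets and transition
  functions \<open>g\<close>. The parameter \<open>Par\<close> is the family of inverse charts of \<open>X\<close>.
\<close>

definition line_bundle ::
  "('n::finite, 'm::finite cproj) params \<Rightarrow> 'm cproj set \<Rightarrow>
   ('i \<Rightarrow> 'm cproj set) \<Rightarrow> ('i \<Rightarrow> 'i \<Rightarrow> 'm cproj \<Rightarrow> complex) \<Rightarrow> bool" where
  "line_bundle Par X T g \<longleftrightarrow>
     (\<forall>i. openin (top_of_set X) (T i)) \<and> (\<Union>i. T i) = X \<and>
     (\<forall>i j. holo_on_variety Par (T i \<inter> T j) (g i j)) \<and>
     (\<forall>i j. \<forall>x\<in>T i \<inter> T j. g i j x \<noteq> 0) \<and>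
     (\<forall>i j k. \<forall>x\<in>T i \<inter> T j \<inter> T k. g i j x * g j k x = g i k x)"

text \<open>
  A section is the family of its local expressions, set to zero outside the trivialising sets so
  that equality of sections is equality of functions.
\<close>

type_synonym ('i, 'm) lsection = "'i \<Rightarrow> 'm cproj \<Rightarrow> complex"

definition holomorphic_sections ::
  "('n::finite, 'm::finite cproj) params \<Rightarrow>
   ('i \<Rightarrow> 'm cproj set) \<Rightarrow> ('i \<Rightarrow> 'i \<Rightarrow> 'm cproj \<Rightarrow> complex) \<Rightarrow> ('i, 'm) lsection set" where
  "holomorphic_sections Par T g =
     {\<sigma>. (\<forall>i. holo_on_variety Par (T i) (\<sigma> i)) \<and>
          (\<forall>i j. \<forall>x\<in>T i \<inter> T j. \<sigma> i x = g i j x * \<sigma> j x) \<and>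
          (\<forall>i. \<forall>x. x \<notin> T i \<longrightarrow> \<sigma> i x = 0)}"

definition sscale :: "complex \<Rightarrow> ('i \<Rightarrow> 'x \<Rightarrow> complex) \<Rightarrow> ('i \<Rightarrow> 'x \<Rightarrow> complex)" where
  "sscale a \<sigma> = (\<lambda>i x. a * \<sigma> i x)"

interpretation sec: vector_space "sscale :: complex \<Rightarrow> ('i \<Rightarrow> 'x \<Rightarrow> complex) \<Rightarrow> _"
  by unfold_locales (auto simp: sscale_def fun_eq_iff algebra_simps)

text \<open>
  Value of a section at \<open>x\<close> in some trivialisation around \<open>x\<close>. Another choice multiplies the values
  of all sections at \<open>x\<close> by the same nonzero factor.
\<close>

definition sval :: "('i \<Rightarrow> 'm::finite cproj set) \<Rightarrow> ('i, 'm) lsection \<Rightarrow> 'm cproj \<Rightarrow> complex" where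
  "sval T \<sigma> x = \<sigma> (SOME i. x \<in> T i) x"

definition squot ::
  "('i \<Rightarrow> 'm::finite cproj set) \<Rightarrow> ('i, 'm) lsection \<Rightarrow> ('i, 'm) lsection \<Rightarrow> 'm cproj \<Rightarrow> complex" where
  "squot T \<sigma> \<tau> x = sval T \<sigma> x / sval T \<tau> x"

definition basis_of :: "('i, 'm::finite) lsection set \<Rightarrow> ('r \<Rightarrow> ('i, 'm) lsection) \<Rightarrow> bool" where
  "basis_of E b \<longleftrightarrow> inj b \<and> sec.independent (range b) \<and> sec.span (range b) = E"

text \<open>Elements of the dual space are linear functionals on \<open>E\<close>, set to zero outside \<open>E\<close>.\<close>

definition dual_space :: "('i, 'm::finite) lsection set \<Rightarrow> (('i, 'm) lsection \<Rightarrow> complex) set" where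
  "dual_space E =
     {l. (\<forall>\<sigma>\<in>E. \<forall>\<tau>\<in>E. l (\<sigma> + \<tau>) = l \<sigma> + l \<tau>) \<and> (\<forall>a. \<forall>\<sigma>\<in>E. l (sscale a \<sigma>) = a * l \<sigma>) \<and>
         (\<forall>\<sigma>. \<sigma> \<notin> E \<longrightarrow> l \<sigma> = 0)}"

definition dual_basis ::
  "('r \<Rightarrow> ('i, 'm::finite) lsection) \<Rightarrow> 'r \<Rightarrow> ('i, 'm) lsection \<Rightarrow> complex" where
  "dual_basis b j = (\<lambda>\<sigma>. sec.representation (range b) \<sigma> (b j))"

definition hermitian_product ::
  "('s \<Rightarrow> complex) set \<Rightarrow> (('s \<Rightarrow> complex) \<Rightarrow> ('s \<Rightarrow> complex) \<Rightarrow> complex) \<Rightarrow> bool" where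
  "hermitian_product V H \<longleftrightarrow>
     (\<forall>k\<in>V. \<forall>l\<in>V. \<forall>m\<in>V. H (k + l) m = H k m + H l m) \<and>
     (\<forall>a. \<forall>k\<in>V. \<forall>l\<in>V. H (\<lambda>s. a * k s) l = a * H k l) \<and>
     (\<forall>k\<in>V. \<forall>l\<in>V. H l k = cnj (H k l)) \<and>
     (\<forall>k\<in>V. k \<noteq> 0 \<longrightarrow> Im (H k k) = 0 \<and> Re (H k k) > 0)"

definition dual_proj :: "('i, 'm::finite) lsection set \<Rightarrow> (('i, 'm) lsection \<Rightarrow> complex) set set" where
  "dual_proj E = {{(\<lambda>\<sigma>. c * l \<sigma>) | c. c \<noteq> 0} | l. l \<in> dual_space E \<and> l \<noteq> 0}"

text \<open>
  A basis \<open>b\<close> of \<open>E\<close> gives homogeneous coordinates \<open>l \<mapsto> (l (b j))\<^sub>j\<close> on the projectivised dual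
  space; the charts are the affine charts of all these coordinate systems.
\<close>

definition dual_proj_charts ::
  "('i, 'm::finite) lsection set \<Rightarrow> ((('i, 'm) lsection \<Rightarrow> complex) set, 'r::finite) charts" where
  "dual_proj_charts E =
     {({q \<in> dual_proj E. \<forall>l\<in>q. l (b i) \<noteq> 0},
       \<lambda>q. \<chi> j. (SOME l. l \<in> q) (b j) / (SOME l. l \<in> q) (b i)) | b i. basis_of E (b :: 'r \<Rightarrow> _)}"

text \<open>The Kodaira map sends a point \<open>x\<close> to the line spanned by the evaluation functional at \<open>x\<close>.\<close>

definition kodaira_map ::
  "('i \<Rightarrow> 'm::finite cproj set) \<Rightarrow> ('i, 'm) lsection set \<Rightarrow> 'm cproj \<Rightarrow>
   (('i, 'm) lsection \<Rightarrow> complex) set" where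
  "kodaira_map T E x = {(\<lambda>\<sigma>. c * (if \<sigma> \<in> E then sval T \<sigma> x else 0)) | c. c \<noteq> 0}"

text \<open>
  The dummy argument in \<open>itself\<close> only names the index type of bases of \<open>E\<close>. The first
  condition says that not all sections in \<open>E\<close> vanish at a point, and the last one that the map is
  open onto its image.
\<close>

definition kodaira_embedding ::
  "'r::finite itself \<Rightarrow> ('n::finite, 'm::finite cproj) params \<Rightarrow> 'm cproj set \<Rightarrow>
   ('i \<Rightarrow> 'm cproj set) \<Rightarrow> ('i, 'm) lsection set \<Rightarrow> bool" where
  "kodaira_embedding R Par X T E \<longleftrightarrow>
     kodaira_map T E ` X \<subseteq> dual_proj E \<and>
     inj_on (kodaira_map T E) X \<and>
     holomorphic_immersion Par
       (dual_proj_charts E :: (_, 'r) charts) X (kodaira_map T E) \<and>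
     (\<forall>Q. openin (top_of_set X) Q \<longrightarrow>
        (\<exists>Q'. chart_open (dual_proj_charts E :: (_, 'r) charts) Q' \<and>
              kodaira_map T E ` Q = Q' \<inter> kodaira_map T E ` X))"


section \<open>Coordinates, power series and the valuation\<close>

definition independent_differentials ::
  "('n::finite, 'm::finite cproj) params \<Rightarrow>
   ('m cproj \<Rightarrow> complex^'n) \<Rightarrow> 'm cproj \<Rightarrow> bool" where
  "independent_differentials Par u p \<longleftrightarrow>
     (\<exists>(W, \<psi>) \<in> Par. \<exists>y\<in>W. \<exists>A :: complex^'n^'n. \<psi> y = p \<and>
        ((u \<circ> \<psi>) has_derivative (\<lambda>h. A *v h)) (at y) \<and>
        (\<forall>a :: complex^'n. (\<Sum>i\<in>UNIV. a$i *s row i A) = 0 \<longrightarrow> a = 0))"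

definition coordinate_system ::
  "'m::finite cproj set \<Rightarrow> 'm cproj \<Rightarrow> ('m cproj \<Rightarrow> complex^'n) \<Rightarrow> bool" where
  "coordinate_system X p u \<longleftrightarrow>
     (\<forall>i. rational_regular_at X (\<lambda>x. u x $ i) p) \<and> u p = 0 \<and>
     independent_differentials (local_params X) u p"

definition biholomorphic_on ::
  "'m::finite cproj set \<Rightarrow> 'm cproj set \<Rightarrow> ('m cproj \<Rightarrow> complex^'n) \<Rightarrow> bool" where
  "biholomorphic_on X U u \<longleftrightarrow>
     open (u ` U) \<and> inj_on u U \<and>
     (\<forall>i. holo_on_variety (local_params X :: ('n, 'm cproj) params) U (\<lambda>x. u x $ i)) \<and>
     (u ` U, inv_into U u) \<in> local_params X"

definition nonneg_vecs :: "(int^'n) set" where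
  "nonneg_vecs = {\<alpha>. \<forall>i. 0 \<le> \<alpha>$i}"

definition monom_vec :: "complex^'n \<Rightarrow> int^'n \<Rightarrow> complex" where
  "monom_vec z \<alpha> = (\<Prod>i\<in>UNIV. z$i powi \<alpha>$i)"

definition wdot :: "int^'n \<Rightarrow> int^'n \<Rightarrow> int" where
  "wdot \<gamma> \<alpha> = (\<Sum>i\<in>UNIV. \<gamma>$i * \<alpha>$i)"

definition supp :: "(int^'n \<Rightarrow> complex) \<Rightarrow> (int^'n) set" where
  "supp c = {\<alpha>. c \<alpha> \<noteq> 0}"

text \<open>\<open>f = \<Sum>\<^sub>\<alpha> c\<^sub>\<alpha> u\<^sup>\<alpha>\<close> near \<open>p\<close>, summed over vectors \<open>\<alpha>\<close> of nonnegative integers.\<close>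

definition power_series_at ::
  "'m::finite cproj set \<Rightarrow> ('m cproj \<Rightarrow> complex^'n) \<Rightarrow> 'm cproj \<Rightarrow> ('m cproj \<Rightarrow> complex) \<Rightarrow>
   (int^'n \<Rightarrow> complex) \<Rightarrow> bool" where
  "power_series_at X u p f c \<longleftrightarrow> supp c \<subseteq> nonneg_vecs \<and>
     (\<exists>W. openin (top_of_set X) W \<and> p \<in> W \<and>
        (\<forall>x\<in>W. ((\<lambda>\<alpha>. c \<alpha> * monom_vec (u x) \<alpha>) has_sum f x) nonneg_vecs))"

definition admissible_order :: "(int^'n \<Rightarrow> int^'n \<Rightarrow> bool) \<Rightarrow> bool" where
  "admissible_order le \<longleftrightarrow> reflp le \<and> transp le \<and> antisymp le \<and> totalp le \<and>
     (\<forall>a b c. le a b \<longrightarrow> le (a + c) (b + c)) \<and>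
     (\<forall>S. S \<subseteq> nonneg_vecs \<and> S \<noteq> {} \<longrightarrow> (\<exists>a\<in>S. \<forall>b\<in>S. le a b))"

text \<open>
  The valuation of a function that is regular at \<open>p\<close> and not identically zero near \<open>p\<close>; the
  quotients \<open>\<sigma> / \<tau>\<close> to which it is applied are of this kind.
\<close>

definition valuation ::
  "'m::finite cproj set \<Rightarrow> ('m cproj \<Rightarrow> complex^'n) \<Rightarrow> 'm cproj \<Rightarrow> (int^'n \<Rightarrow> int^'n \<Rightarrow> bool) \<Rightarrow>
   ('m cproj \<Rightarrow> complex) \<Rightarrow> int^'n" where
  "valuation X u p le f =
     (let S = supp (THE c. power_series_at X u p f c) in THE a. a \<in> S \<and> (\<forall>b\<in>S. le a b))"

definition value_set ::
  "'m::finite cproj set \<Rightarrow> ('m cproj \<Rightarrow> complex^'n) \<Rightarrow> 'm cproj \<Rightarrow> (int^'n \<Rightarrow> int^'n \<Rightarrow> bool) \<Rightarrow>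
   ('i \<Rightarrow> 'm cproj set) \<Rightarrow> ('i, 'm) lsection set \<Rightarrow> ('i, 'm) lsection \<Rightarrow> (int^'n) set" where
  "value_set X u p le T E \<tau> = {valuation X u p le (squot T \<sigma> \<tau>) | \<sigma>. \<sigma> \<in> E \<and> \<sigma> \<noteq> 0}"

definition differences_generate :: "(int^'n) set \<Rightarrow> bool" where
  "differences_generate A \<longleftrightarrow> module.span (*s) {a - b | a b. a \<in> A \<and> b \<in> A} = UNIV"


section \<open>The family and the map to projective space\<close>

text \<open>
  Coordinates \<open>(w, t)\<close> on \<open>\<complex>\<^sup>n\<^sup>+\<^sup>1\<close> are indexed by \<open>'n option\<close>, the index \<open>None\<close> carrying the last
  coordinate \<open>t\<close>.
\<close>

definition with_last :: "complex^'n \<Rightarrow> complex \<Rightarrow> complex^('n option)" where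
  "with_last w t = (\<chi> k. case k of None \<Rightarrow> t | Some i \<Rightarrow> w$i)"

definition but_last :: "complex^('n option) \<Rightarrow> complex^'n" where
  "but_last z = (\<chi> i. z $ Some i)"

definition glue_map ::
  "('m::finite cproj \<Rightarrow> complex^'n) \<Rightarrow> int^'n \<Rightarrow> 'm cproj \<times> complex \<Rightarrow> complex^('n option)" where
  "glue_map u \<gamma> = (\<lambda>(x, t). with_last (\<chi> i. t powi (- (\<gamma>$i)) * u x $ i) t)"

definition glue_chart ::
  "'m::finite cproj set \<Rightarrow> ('m cproj \<Rightarrow> complex^'n) \<Rightarrow> int^'n \<Rightarrow> (complex^('n option)) set" where
  "glue_chart U u \<gamma> =
     glue_map u \<gamma> ` (U \<times> (- {0})) \<union> {with_last w 0 | w. \<forall>i. w$i \<noteq> 0}"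

type_synonym ('m, 'n) pre_family = "'m cproj \<times> complex + complex^('n option)"

definition pre_family ::
  "'m::finite cproj set \<Rightarrow> 'm cproj set \<Rightarrow> ('m cproj \<Rightarrow> complex^'n) \<Rightarrow> int^'n \<Rightarrow>
   ('m, 'n) pre_family set" where
  "pre_family X U u \<gamma> = (X \<times> (- {0})) <+> glue_chart U u \<gamma>"

definition glue_rel ::
  "'m::finite cproj set \<Rightarrow> 'm cproj set \<Rightarrow> ('m cproj \<Rightarrow> complex^'n) \<Rightarrow> int^'n \<Rightarrow>
   (('m, 'n) pre_family) rel" where
  "glue_rel X U u \<gamma> = Id_on (pre_family X U u \<gamma>) \<union>
     {(Inl y, Inr (glue_map u \<gamma> y)) | y. y \<in> U \<times> (- {0})} \<union>
     {(Inr (glue_map u \<gamma> y), Inl y) | y. y \<in> U \<times> (- {0})}"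

text \<open>Points of the family are classes of the disjoint union under the gluing relation.\<close>

definition family ::
  "'m::finite cproj set \<Rightarrow> 'm cproj set \<Rightarrow> ('m cproj \<Rightarrow> complex^'n) \<Rightarrow> int^'n \<Rightarrow>
   ('m, 'n) pre_family set set" where
  "family X U u \<gamma> = pre_family X U u \<gamma> // glue_rel X U u \<gamma>"

text \<open>Inverse charts: products of those of \<open>X\<close> with the punctured line, and the glued open set.\<close>

definition family_params ::
  "'m::finite cproj set \<Rightarrow> 'm cproj set \<Rightarrow> ('m cproj \<Rightarrow> complex^'n) \<Rightarrow> int^'n \<Rightarrow>
   ('n::finite option, ('m, 'n) pre_family set) params" where
  "family_params X U u \<gamma> =
     {({z. but_last z \<in> W \<and> z $ None \<noteq> 0},
       \<lambda>z. glue_rel X U u \<gamma> `` {Inl (\<psi> (but_last z), z $ None)}) | W \<psi>. (W, \<psi>) \<in> local_params X} \<union>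
     {(glue_chart U u \<gamma>, \<lambda>z. glue_rel X U u \<gamma> `` {Inr z})}"

definition family_proj :: "('m::finite, 'n::finite) pre_family set \<Rightarrow> complex" where
  "family_proj q = the_elem ((\<lambda>a. case a of Inl y \<Rightarrow> snd y | Inr z \<Rightarrow> z $ None) ` q)"

text \<open>
  On \<open>X \<times> \<complex>\<^sup>*\<close> the map is given by the sections \<open>\<eta>\<^sub>j\<close> rather than the quotients \<open>f\<^sub>j = \<eta>\<^sub>j / \<tau>\<close>, which
  have the same ratios and makes sense also where \<open>\<tau>\<close> vanishes. A class without a representative in
  \<open>X \<times> \<complex>\<^sup>*\<close> is a point of the zero fibre, where the power series is evaluated (at \<open>z $ None = 0\<close>;
  \<open>0 powi 0 = 1\<close> and \<open>0 powi k = 0\<close> for \<open>k > 0\<close>).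
\<close>

definition family_coords ::
  "('i \<Rightarrow> 'm::finite cproj set) \<Rightarrow> int^'n \<Rightarrow> ('r::finite \<Rightarrow> ('i, 'm) lsection) \<Rightarrow>
   ('r \<Rightarrow> int^'n) \<Rightarrow> ('r \<Rightarrow> int^'n \<Rightarrow> complex) \<Rightarrow> ('m, 'n) pre_family set \<Rightarrow> complex^'r" where
  "family_coords T \<gamma> \<eta> \<beta> c q =
     (if \<exists>y. Inl y \<in> q
      then let (x, t) = THE y. Inl y \<in> q in \<chi> j. t powi (- wdot \<gamma> (\<beta> j)) * sval T (\<eta> j) x
      else let z = THE z. Inr z \<in> q in
        \<chi> j. \<Sum>\<^sub>\<infinity>\<alpha>\<in>nonneg_vecs.
          c j \<alpha> * monom_vec (but_last z) \<alpha> * z $ None powi (wdot \<gamma> \<alpha> - wdot \<gamma> (\<beta> j)))"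

definition family_map ::
  "('i \<Rightarrow> 'm::finite cproj set) \<Rightarrow> int^'n \<Rightarrow> ('r::finite \<Rightarrow> ('i, 'm) lsection) \<Rightarrow>
   ('r \<Rightarrow> int^'n) \<Rightarrow> ('r \<Rightarrow> int^'n \<Rightarrow> complex) \<Rightarrow> ('m, 'n) pre_family set \<Rightarrow> 'r cproj \<times> complex" where
  "family_map T \<gamma> \<eta> \<beta> c q = (pt (family_coords T \<gamma> \<eta> \<beta> c q), family_proj q)"

definition cproj_times_line_charts ::
  "('r::finite cproj \<times> complex, 'r option) charts" where
  "cproj_times_line_charts =
     {(V \<times> UNIV, \<lambda>(x, t). with_last (\<kappa> x) t) | V \<kappa>. (V, \<kappa>) \<in> cproj_charts}"

end

theory Submission
  imports Defs
begin

text \<open>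
  A map to projective space that is given by homogeneous coordinates \<open>G\<close> is immersive at a point iff no
  nonzero tangent vector \<open>h\<close> satisfies \<open>dG (h) = \<lambda> G\<close> for a scalar \<open>\<lambda>\<close>. As the second component of
  \<open>F\<close> is the projection to \<open>t\<close>, only vectors along the fibres of the family matter
  (\<open>holo_with_rank_at_homogeneousI\<close>). The relation is excluded for two different reasons.

  On \<open>X \<times> \<complex>\<^sup>*\<close>, the restriction of \<open>F\<close> to a fibre is the Kodaira map followed by the
  invertible diagonal matrix of the powers \<open>t powi (- \<gamma> \<cdot> \<beta>\<^sub>j)\<close>, which is immersive because the Kodaira map is (\<open>family_map_immersive_general\<close>).

  On the zero fibre, \<open>F\<close> is the monomial map with exponents \<open>\<beta>\<^sub>j\<close>: the weight \<open>\<gamma>\<close> was chosen so that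
  \<open>\<beta>\<^sub>j\<close> is the only exponent of \<open>f\<^sub>j\<close> that survives at \<open>t = 0\<close>. At a point \<open>w\<close> of the torus the
  relation \<open>dG (h) = \<lambda> G\<close> becomes \<open>\<beta>\<^sub>j \<cdot> k = \<lambda>\<close> for all \<open>j\<close>, where \<open>k\<^sub>i = h\<^sub>i / w\<^sub>i\<close>. So \<open>k\<close> is orthogonal to all
  differences of elements of the value set. These generate \<open>\<int>\<^sup>n\<close>, hence \<open>k = 0\<close>
  (\<open>family_map_immersive_zero_fibre\<close>).

  The analytic part of the second case is that the series in \<open>(w, t)\<close> obtained from \<open>f\<^sub>j\<close> by the
  substitution \<open>u = t\<^sup>\<gamma> w\<close> and division by the lowest power of \<open>t\<close> converges, and is holomorphic, near every point of the zero fibre, even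
  though \<open>w\<close> may be large: as \<open>\<gamma>\<close> is positive, a small \<open>t\<close> compensates for a large \<open>w\<close>
  (\<open>family_series_has_cderiv\<close>). It rests on term-by-term differentiation of unordered sums
  (\<open>has_derivative_infsum\<close>).
\<close>

section \<open>Complex differentiation in several variables\<close>

text \<open>
  The derivative is kept as a function, so that the rules of differentiation yield it directly.
  Homogeneity over \<open>\<complex>\<close> is the Cauchy-Riemann condition; together with the real linearity that is part of
  \<open>has_derivative\<close> it makes \<open>f'\<close> a row vector of complex numbers.
\<close>

definition has_cderiv ::
  "(complex^'k::finite \<Rightarrow> complex) \<Rightarrow> (complex^'k \<Rightarrow> complex) \<Rightarrow> complex^'k \<Rightarrow> bool" where
  "has_cderiv f f' z \<longleftrightarrow> (f has_derivative f') (at z) \<and> (\<forall>s h. f' (s *s h) = s * f' h)"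

lemma has_cderiv_gradient:
  assumes "has_cderiv f f' z"
  shows "f' h = (\<Sum>i\<in>UNIV. f' (axis i 1) * h$i)"
proof -
  have lin: "linear f'"
    using assms unfolding has_cderiv_def by (blast intro: has_derivative_linear)
  have "f' h = f' (\<Sum>i\<in>UNIV. h$i *s axis i 1)"
    by (simp add: basis_expansion)
  also have "\<dots> = (\<Sum>i\<in>UNIV. f' (h$i *s axis i 1))"
    using lin by (simp add: linear_sum)
  also have "\<dots> = (\<Sum>i\<in>UNIV. f' (axis i 1) * h$i)"
    using assms by (simp add: has_cderiv_def mult.commute)
  finally show ?thesis .
qed

lemma has_derivative_vec_componentwise:
  fixes f :: "'a::real_normed_vector \<Rightarrow> complex^'l::finite"
  assumes "\<And>j. ((\<lambda>z. f z $ j) has_derivative (\<lambda>h. f' h $ j)) F"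
  shows "(f has_derivative f') F"
proof -
  have bl: "bounded_linear (axis j :: complex \<Rightarrow> complex^'l)" for j
    by (intro linear_linear[THEN iffD2] linearI)
      (auto simp: axis_def vec_eq_iff)
  have "((\<lambda>z. \<Sum>j\<in>UNIV. axis j (f z $ j)) has_derivative (\<lambda>h. \<Sum>j\<in>UNIV. axis j (f' h $ j))) F"
    by (intro has_derivative_sum bounded_linear.has_derivative[OF bl] assms)
  moreover have "(\<Sum>j\<in>UNIV. axis j (x $ j)) = x" for x :: "complex^'l"
    by (simp add: vec_eq_iff axis_def)
  ultimately show ?thesis by simp
qed

lemma has_cderiv_matrix:
  fixes f :: "complex^'k::finite \<Rightarrow> complex^'l::finite"
  assumes "\<And>j. has_cderiv (\<lambda>z. f z $ j) (F j) z"
  obtains A :: "complex^'k^'l" where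
    "(f has_derivative (\<lambda>h. A *v h)) (at z)" "\<And>h j. (A *v h) $ j = F j h"
proof
  show comp: "((\<chi> j i. F j (axis i 1)) *v h) $ j = F j h" for h j
    unfolding has_cderiv_gradient[OF assms, of _ h] by (simp add: matrix_vector_mult_def)
  show "(f has_derivative (\<lambda>h. (\<chi> j i. F j (axis i 1)) *v h)) (at z)"
    using assms by (intro has_derivative_vec_componentwise) (simp add: comp has_cderiv_def)
qed

lemma matrix_has_cderiv:
  assumes "(f has_derivative (\<lambda>h. A *v h)) (at z)"
  shows "has_cderiv (\<lambda>z. f z $ j) (\<lambda>h. (A *v h) $ j) z"
  unfolding has_cderiv_def
  using bounded_linear.has_derivative[OF bounded_linear_vec_nth assms]
  by (simp add: matrix_vector_mult_scaleR vector_scalar_commute)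

lemma has_cderiv_continuous_on:
  assumes "\<And>z j. z \<in> S \<Longrightarrow> \<exists>D. has_cderiv (\<lambda>z. G z $ j) D z"
  shows "continuous_on S G"
proof (rule continuous_at_imp_continuous_on, rule ballI)
  fix z assume "z \<in> S"
  then have "isCont (\<lambda>z. G z $ j) z" for j
    using assms unfolding has_cderiv_def by (blast intro: has_derivative_continuous)
  then show "isCont G z" unfolding isCont_def by (intro vec_tendstoI)
qed

lemma has_cderiv_unique:
  assumes "has_cderiv f f' z" "has_cderiv f f'' z"
  shows "f' = f''"
  using assms unfolding has_cderiv_def by (blast intro: has_derivative_unique)

lemma has_cderiv_transform:
  assumes "has_cderiv f f' z" "open S" "z \<in> S" "\<And>y. y \<in> S \<Longrightarrow> f y = g y"
  shows "has_cderiv g f' z"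
  using assms unfolding has_cderiv_def by (metis has_derivative_transform_within_open)

lemma has_cderiv_mult:
  assumes "has_cderiv f f' z" "has_cderiv g g' z"
  shows "has_cderiv (\<lambda>z. f z * g z) (\<lambda>h. f z * g' h + f' h * g z) z"
  using assms unfolding has_cderiv_def
  by (auto intro: has_derivative_mult simp: algebra_simps)

lemma has_cderiv_divide:
  assumes "has_cderiv f f' z" "has_cderiv g g' z" "g z \<noteq> 0"
  shows "has_cderiv (\<lambda>z. f z / g z) (\<lambda>h. (f' h * g z - f z * g' h) / (g z * g z)) z"
  unfolding has_cderiv_def
proof (intro conjI allI)
  show "((\<lambda>z. f z / g z) has_derivative (\<lambda>h. (f' h * g z - f z * g' h) / (g z * g z))) (at z)"
    using assms unfolding has_cderiv_def by (intro has_derivative_divide') auto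
qed (use assms in \<open>auto simp: has_cderiv_def algebra_simps diff_divide_distrib\<close>)

lemma has_cderiv_sum:
  assumes "\<And>i. i \<in> I \<Longrightarrow> has_cderiv (f i) (f' i) z"
  shows "has_cderiv (\<lambda>z. \<Sum>i\<in>I. a i * f i z) (\<lambda>h. \<Sum>i\<in>I. a i * f' i h) z"
  using assms unfolding has_cderiv_def
  by (auto intro!: has_derivative_sum derivative_eq_intros simp: sum_distrib_left algebra_simps)

lemma has_cderiv_nth: "has_cderiv (\<lambda>z. z $ i) (\<lambda>h. h $ i) z"
  unfolding has_cderiv_def
  by (auto intro!: bounded_linear.has_derivative[OF bounded_linear_vec_nth] derivative_intros)

lemma has_cderiv_field_comp:
  assumes "(f has_field_derivative d) (at (g z))" "has_cderiv g g' z"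
  shows "has_cderiv (\<lambda>z. f (g z)) (\<lambda>h. d * g' h) z"
  using assms unfolding has_cderiv_def has_field_derivative_def
  by (auto dest: has_derivative_compose[of g g' z UNIV f "(*) d"])

lemma has_cderiv_matrix_comp:
  fixes f :: "complex^'k::finite \<Rightarrow> complex" and L :: "complex^'l::finite \<Rightarrow> complex^'k"
  assumes "has_cderiv f f' (L z)" "bounded_linear L" "\<And>s h. L (s *s h) = s *s L h"
  shows "has_cderiv (\<lambda>z. f (L z)) (\<lambda>h. f' (L h)) z"
  using assms has_derivative_compose[OF bounded_linear_imp_has_derivative[OF assms(2)], of f f' z]
  unfolding has_cderiv_def by auto

lemma full_rank_iff_kernel:
  fixes A :: "'a::field^'n^'m"
  shows "rank A = CARD('n) \<longleftrightarrow> (\<forall>x. A *v x = 0 \<longrightarrow> x = 0)"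
proof -
  have "(\<forall>x. A *v x = 0 \<longrightarrow> x = 0) \<longleftrightarrow> vec.span (rows A) = UNIV"
    by (metis matrix_left_invertible_ker matrix_left_invertible_span_rows_gen)
  also have "\<dots> \<longleftrightarrow> vec.dim (rows A) = CARD('n)"
    by (metis vec.dim_eq_full vec_dim_card vec.dim_UNIV vec.dimension_def card_cart_basis)
  finally show ?thesis by (simp add: row_rank_def_gen)
qed

text \<open>
  Term-by-term differentiation under a Weierstrass majorant \<open>M\<close> of the derivatives. By the mean value
  inequality each remainder \<open>F\<^sub>i y - F\<^sub>i x - F\<^sub>i' (y - x)\<close> is at most \<open>2 M\<^sub>i \<bar>y - x\<bar>\<close>, so all but finitely
  many of them contribute little, uniformly in \<open>y\<close>, and the finitely many others are differentiable.
\<close>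

lemma has_derivative_infsum:
  fixes F :: "'i \<Rightarrow> 'a::real_normed_vector \<Rightarrow> 'b::banach"
  assumes S: "open S" "convex S" "x \<in> S"
    and der: "\<And>i y. i \<in> I \<Longrightarrow> y \<in> S \<Longrightarrow> (F i has_derivative F' i y) (at y)"
    and bound: "\<And>i y h. i \<in> I \<Longrightarrow> y \<in> S \<Longrightarrow> norm (F' i y h) \<le> M i * norm h"
    and M: "\<And>i. i \<in> I \<Longrightarrow> 0 \<le> M i" "M summable_on I"
    and F: "\<And>y. y \<in> S \<Longrightarrow> (\<lambda>i. F i y) summable_on I"
  shows "((\<lambda>y. \<Sum>\<^sub>\<infinity>i\<in>I. F i y) has_derivative (\<lambda>h. \<Sum>\<^sub>\<infinity>i\<in>I. F' i x h)) (at x)"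
proof -
  define D where "D h = (\<Sum>\<^sub>\<infinity>i\<in>I. F' i x h)" for h
  have abs: "(\<lambda>i. norm (F' i x h)) summable_on I" for h
    by (rule Infinite_Sum.abs_summable_on_comparison_test'[of "\<lambda>i. M i * norm h"])
      (auto intro: summable_on_cmult_left M bound S)
  have summ: "(\<lambda>i. F' i x h) summable_on I" for h
    by (rule Infinite_Sum.abs_summable_summable[OF abs])
  have lin: "linear (F' i x)" if "i \<in> I" for i
    using der[OF that \<open>x \<in> S\<close>] bounded_linear.linear has_derivative_bounded_linear by blast
  have bl: "bounded_linear D"
  proof (rule bounded_linear_intro[where K = "infsum M I"])
    show "D (h + k) = D h + D k" for h k
      unfolding D_def using summ lin
      by (subst infsum_add[symmetric]) (auto intro!: infsum_cong simp: linear_add)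
    show "D (r *\<^sub>R h) = r *\<^sub>R D h" for r h
      unfolding D_def using lin
      by (subst infsum_scaleR_right[symmetric]) (auto intro!: infsum_cong simp: linear_scale)
    show "norm (D h) \<le> norm h * infsum M I" for h
    proof -
      have "norm (D h) \<le> (\<Sum>\<^sub>\<infinity>i\<in>I. norm (F' i x h))"
        unfolding D_def by (rule norm_infsum_bound[OF abs])
      also have "\<dots> \<le> (\<Sum>\<^sub>\<infinity>i\<in>I. M i * norm h)"
        using bound S abs by (intro infsum_mono summable_on_cmult_left M) auto
      finally show ?thesis
        by (simp add: infsum_cmult_left' mult.commute)
    qed
  qed
  have "\<exists>d>0. \<forall>y. norm (y - x) < d \<longrightarrow>
      norm ((\<Sum>\<^sub>\<infinity>i\<in>I. F i y) - (\<Sum>\<^sub>\<infinity>i\<in>I. F i x) - D (y - x)) \<le> e * norm (y - x)"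
    if "e > 0" for e
  proof -
    from infsum_finite_approximation[OF M(2), of "e/4"] \<open>e > 0\<close>
    obtain J where J: "finite J" "J \<subseteq> I" "dist (sum M J) (infsum M I) \<le> e/4" by auto
    have "infsum M (I - J) = infsum M I - sum M J"
      using J M by (subst infsum_Diff) auto
    with J(3) have tailM: "infsum M (I - J) \<le> e/4"
      unfolding dist_real_def by linarith
    have "((\<lambda>y. \<Sum>i\<in>J. F i y) has_derivative (\<lambda>h. \<Sum>i\<in>J. F' i x h)) (at x)"
      using J der S by (intro has_derivative_sum) auto
    then obtain d1 where d1: "d1 > 0" "\<And>y. norm (y - x) < d1 \<Longrightarrow>
        norm ((\<Sum>i\<in>J. F i y) - (\<Sum>i\<in>J. F i x) - (\<Sum>i\<in>J. F' i x (y - x))) \<le> e/2 * norm (y - x)"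
      unfolding has_derivative_at_alt using \<open>e > 0\<close> by (metis half_gt_zero)
    obtain d2 where d2: "d2 > 0" "ball x d2 \<subseteq> S"
      using S openE by blast
    show ?thesis
    proof (intro exI[of _ "min d1 d2"] conjI allI impI)
      show "min d1 d2 > 0" using d1 d2 by simp
      fix y assume y: "norm (y - x) < min d1 d2"
      then have yS: "y \<in> S" using d2 by (auto simp: dist_norm norm_minus_commute subset_iff)
      define R where "R i = F i y - F i x - F' i x (y - x)" for i
      have Rsum: "(R has_sum ((\<Sum>\<^sub>\<infinity>i\<in>I. F i y) - (\<Sum>\<^sub>\<infinity>i\<in>I. F i x) - D (y - x))) I"
        unfolding R_def D_def diff_conv_add_uminus
        by (intro has_sum_add has_sum_uminus[THEN iffD2])
          (simp_all only: minus_minus has_sum_infsum F summ S yS diff_conv_add_uminus[symmetric])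
      have Rb: "norm (R i) \<le> 2 * norm (y - x) * M i" if "i \<in> I" for i
      proof -
        have "norm (F i y - F i x) \<le> M i * norm (y - x)"
        proof (rule differentiable_bound[OF S(2)])
          show "(F i has_derivative F' i z) (at z within S)" if "z \<in> S" for z
            using der[OF \<open>i \<in> I\<close> that] has_derivative_at_withinI by blast
          show "onorm (F' i z) \<le> M i" if "z \<in> S" for z
            using bound[OF \<open>i \<in> I\<close> that] M(1)[OF \<open>i \<in> I\<close>] by (intro onorm_bound) auto
        qed (use S yS in auto)
        moreover have "norm (F' i x (y - x)) \<le> M i * norm (y - x)"
          using bound S that by auto
        ultimately show ?thesis
          unfolding R_def using norm_triangle_ineq4[of "F i y - F i x" "F' i x (y - x)"]
          by (simp add: algebra_simps)
      qed
      have "(\<Sum>\<^sub>\<infinity>i\<in>I. F i y) - (\<Sum>\<^sub>\<infinity>i\<in>I. F i x) - D (y - x) = infsum R I"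
        using Rsum by (simp add: infsumI)
      also have "\<dots> = sum R J + infsum R (I - J)"
        using J has_sum_imp_summable[OF Rsum] by (subst infsum_Diff) auto
      also have "norm \<dots> \<le> e/2 * norm (y - x) + e/2 * norm (y - x)"
      proof (rule norm_triangle_mono)
        show "norm (sum R J) \<le> e/2 * norm (y - x)"
          using d1(2)[of y] y unfolding R_def by (simp add: sum_subtractf)
        have Mt: "(\<lambda>i. 2 * norm (y - x) * M i) summable_on (I - J)"
          by (intro summable_on_cmult_right summable_on_subset_banach[OF M(2)]) auto
        have "norm (infsum R (I - J)) \<le> (\<Sum>\<^sub>\<infinity>i\<in>I - J. norm (R i))"
          using Rb by (intro norm_infsum_bound Infinite_Sum.abs_summable_on_comparison_test'[OF Mt]) auto
        also have "\<dots> \<le> (\<Sum>\<^sub>\<infinity>i\<in>I - J. 2 * norm (y - x) * M i)"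
          using Rb by (intro infsum_mono Mt Infinite_Sum.abs_summable_on_comparison_test'[OF Mt]) auto
        also have "\<dots> = 2 * norm (y - x) * infsum M (I - J)"
          by (simp add: infsum_cmult_right')
        also have "\<dots> \<le> 2 * norm (y - x) * (e/4)"
          using tailM by (intro mult_left_mono) auto
        finally show "norm (infsum R (I - J)) \<le> e/2 * norm (y - x)" by (simp add: algebra_simps)
      qed
      finally show "norm ((\<Sum>\<^sub>\<infinity>i\<in>I. F i y) - (\<Sum>\<^sub>\<infinity>i\<in>I. F i x) - D (y - x)) \<le> e * norm (y - x)"
        by (simp add: algebra_simps)
    qed
  qed
  then show ?thesis
    unfolding has_derivative_at_alt using bl by (simp add: D_def[abs_def])
qed

text \<open>
  Doubling the radius absorbs the factor \<open>n\<close> that differentiation produces, since \<open>n \<le> 2\<^sup>n\<close>.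
\<close>

lemma power_derivative_bound:
  fixes x r :: real
  assumes "0 \<le> x" "x \<le> r" "0 < r"
  shows "real n * x ^ (n - 1) \<le> (2 * r) ^ n / r"
proof (cases n)
  case 0
  then show ?thesis using assms by simp
next
  case (Suc k)
  have "real (Suc k) * x ^ k \<le> 2 ^ Suc k * r ^ k"
  proof (intro mult_mono power_mono)
    show "real (Suc k) \<le> 2 ^ Suc k"
      by (metis less_exp less_imp_le of_nat_le_iff of_nat_numeral of_nat_power)
  qed (use assms in auto)
  then show ?thesis using assms Suc by (simp add: power_mult_distrib field_simps)
qed

text \<open>
  The exponents are arbitrary functions \<open>m i\<close>, and different indices may have the same exponent, so
  that the lemma applies to series obtained from a power series by a monomial substitution. Absolute
  convergence on the polydisc of twice the radii majorises the series and its derivatives.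
\<close>

lemma power_series_has_cderiv:
  fixes a :: "'i \<Rightarrow> complex" and m :: "'i \<Rightarrow> 'k::finite \<Rightarrow> nat" and r :: "'k \<Rightarrow> real"
  assumes r: "\<And>k. 0 < r k"
    and conv: "(\<lambda>i. norm (a i) * (\<Prod>k\<in>UNIV. (2 * r k) ^ m i k)) summable_on I"
    and z: "\<And>k. norm (z $ k) < r k"
  shows "\<exists>D. has_cderiv (\<lambda>z. \<Sum>\<^sub>\<infinity>i\<in>I. a i * (\<Prod>k\<in>UNIV. z $ k ^ m i k)) D z"
proof -
  define S where "S = {z :: complex^'k. \<forall>k. norm (z $ k) < r k}"
  define F where "F i z = a i * (\<Prod>k\<in>UNIV. z $ k ^ m i k)" for i and z :: "complex^'k"
  define F' where "F' i z h = a i * (\<Sum>l\<in>UNIV. of_nat (m i l) * z $ l ^ (m i l - 1) * h $ l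
      * (\<Prod>k\<in>UNIV - {l}. z $ k ^ m i k))" for i and z h :: "complex^'k"
  define P where "P i = (\<Prod>k\<in>UNIV. (2 * r k) ^ m i k)" for i
  define M where "M i = norm (a i) * P i * (\<Sum>l\<in>UNIV. 1 / r l)" for i
  have P0: "P i \<ge> 0" for i
    unfolding P_def using r by (intro prod_nonneg) (simp add: less_imp_le)
  have openS: "open S"
    unfolding S_def by (simp add: Collect_all_eq, intro open_INT)
      (auto intro!: open_Collect_less continuous_intros)
  have convS: "convex S"
  proof -
    have "S = (\<Inter>k. (\<lambda>z. z $ k) -` ball 0 (r k))"
      by (auto simp: S_def)
    then show ?thesis
      by (auto intro!: convex_INT convex_linear_vimage bounded_linear.linear bounded_linear_vec_nth)
  qed
  have der: "(F i has_derivative F' i y) (at y)" for i y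
    unfolding F_def F'_def
    by (rule has_derivative_eq_rhs, (rule derivative_intros bounded_linear.has_derivative[OF bounded_linear_vec_nth])+)
      (auto simp: fun_eq_iff algebra_simps)
  have bound: "norm (F' i y h) \<le> M i * norm h" if "y \<in> S" for i y h
  proof -
    have "norm (of_nat (m i l) * y $ l ^ (m i l - 1) * h $ l * (\<Prod>k\<in>UNIV - {l}. y $ k ^ m i k))
        \<le> P i / r l * norm h" for l
    proof -
      have "norm (of_nat (m i l) * y $ l ^ (m i l - 1) * h $ l * (\<Prod>k\<in>UNIV - {l}. y $ k ^ m i k))
        = (real (m i l) * norm (y $ l) ^ (m i l - 1)) * (\<Prod>k\<in>UNIV - {l}. norm (y $ k) ^ m i k) * norm (h $ l)"
        by (simp add: norm_mult norm_power prod_norm[symmetric])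
      also have "\<dots> \<le> ((2 * r l) ^ m i l / r l) * (\<Prod>k\<in>UNIV - {l}. (2 * r k) ^ m i k) * norm h"
      proof (intro mult_mono prod_mono conjI power_mono)
        show "real (m i l) * norm (y $ l) ^ (m i l - 1) \<le> (2 * r l) ^ m i l / r l"
          using that r by (intro power_derivative_bound) (auto simp: S_def less_imp_le)
        show "norm (y $ k) \<le> 2 * r k" for k
          using that r[of k] unfolding S_def by (smt (verit) mem_Collect_eq)
        show "norm (h $ l) \<le> norm h" by (rule Finite_Cartesian_Product.norm_nth_le)
      qed (use r in \<open>auto intro!: prod_nonneg mult_nonneg_nonneg divide_nonneg_pos simp: less_imp_le\<close>)
      also have "\<dots> = P i / r l * norm h"
        unfolding P_def by (subst (2) prod.remove[of _ l]) auto
      finally show ?thesis .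
    qed
    then have "norm (F' i y h) \<le> norm (a i) * (\<Sum>l\<in>UNIV. P i / r l * norm h)"
      unfolding F'_def norm_mult[of "a i"]
      by (intro mult_left_mono order_trans[OF norm_sum] sum_mono) (simp_all del: times_divide_eq_left)
    also have "\<dots> = M i * norm h"
      unfolding M_def by (simp add: sum_distrib_left sum_distrib_right algebra_simps)
    finally show ?thesis .
  qed
  have Msum: "M summable_on I"
    unfolding M_def P_def using conv by (intro summable_on_cmult_left)
  have Fsum: "(\<lambda>i. F i y) summable_on I" if "y \<in> S" for y
  proof (rule Infinite_Sum.abs_summable_summable, rule Infinite_Sum.abs_summable_on_comparison_test'[OF conv])
    show "norm (F i y) \<le> norm (a i) * (\<Prod>k\<in>UNIV. (2 * r k) ^ m i k)" for i
      unfolding F_def norm_mult prod_norm[symmetric] norm_power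
    proof (intro mult_left_mono prod_mono conjI power_mono)
      show "norm (y $ k) \<le> 2 * r k" for k
        using that r[of k] unfolding S_def by (smt (verit) mem_Collect_eq)
    qed auto
  qed
  have "((\<lambda>y. \<Sum>\<^sub>\<infinity>i\<in>I. F i y) has_derivative (\<lambda>h. \<Sum>\<^sub>\<infinity>i\<in>I. F' i z h)) (at z)"
  proof (rule has_derivative_infsum[OF openS convS _ der bound _ Msum Fsum])
    show "z \<in> S" using z by (simp add: S_def)
    show "0 \<le> M i" for i
      unfolding M_def using P0 r by (intro mult_nonneg_nonneg sum_nonneg) (auto simp: less_imp_le)
  qed
  moreover have "F' i z (s *s h) = s * F' i z h" for i s h
    unfolding F'_def by (simp add: sum_distrib_left algebra_simps)
  ultimately have "has_cderiv (\<lambda>y. \<Sum>\<^sub>\<infinity>i\<in>I. F i y) (\<lambda>h. \<Sum>\<^sub>\<infinity>i\<in>I. F' i z h) z"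
    unfolding has_cderiv_def by (simp add: infsum_cmult_right')
  then show ?thesis unfolding F_def by blast
qed

section \<open>Points of projective space\<close>

lemma pt_scale:
  assumes "v \<noteq> 0" "s \<noteq> 0"
  shows "pt (s *s v) = pt v"
  using assms Quotient3_rel_abs[OF Quotient3_cproj, of v "s *s v"]
  by (auto simp: vector_mul_eq_0)

lemma hcoord_pt:
  assumes "v \<noteq> 0"
  obtains s where "s \<noteq> 0" "hcoord (pt v) = s *s v"
proof -
  obtain s where s: "s \<noteq> 0" "v = s *s hcoord (pt v)"
    using Quotient3_rep_abs[OF Quotient3_cproj, of v] assms
    by (metis vector_smult_lid one_neq_zero)
  have "hcoord (pt v) = inverse s *s v"
    using s by (metis left_inverse vector_smult_assoc vector_smult_lid)
  with s(1) that show ?thesis by (metis nonzero_imp_inverse_nonzero)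
qed

lemma hcoord_pt_nth:
  assumes "v $ k \<noteq> 0"
  shows "hcoord (pt v) $ k \<noteq> 0" "affine_coords k (pt v) = (\<chi> j. v $ j / v $ k)"
proof -
  have "v \<noteq> 0" using assms by auto
  then obtain s where "s \<noteq> 0" "hcoord (pt v) = s *s v" by (rule hcoord_pt)
  with assms show "hcoord (pt v) $ k \<noteq> 0" "affine_coords k (pt v) = (\<chi> j. v $ j / v $ k)"
    by (auto simp: affine_coords_def vec_eq_iff)
qed

lemma pt_hcoord: "pt (hcoord x) = x"
  using Quotient3_abs_rep[OF Quotient3_cproj] .

lemma hcoord_nonzero: "hcoord x \<noteq> 0"
  using Quotient3_rep_reflp[OF Quotient3_cproj, of x] by auto

lemma pt_affine_coords:
  assumes "hcoord x $ k \<noteq> 0"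
  shows "pt (affine_coords k x) = x"
proof -
  have "affine_coords k x = inverse (hcoord x $ k) *s hcoord x"
    by (simp add: affine_coords_def vec_eq_iff divide_inverse mult.commute)
  then show ?thesis using assms by (simp add: pt_scale hcoord_nonzero pt_hcoord)
qed

section \<open>A criterion for maps to projective space times a line\<close>

lemma with_last_nth [simp]:
  "with_last w t $ None = t" "with_last w t $ Some i = w $ i"
  by (auto simp: with_last_def)

lemma holo_map_continuous_on: "holo_map f S \<Longrightarrow> continuous_on S f"
  unfolding holo_map_def
  by (meson continuous_at_imp_continuous_on has_derivative_continuous)

text \<open>
  Immersivity is read off from homogeneous coordinates \<open>G\<close>. A vector is in the kernel of the derivative
  of \<open>(pt \<circ> G, t)\<close> iff its last coordinate is zero and \<open>dG\<close> maps it to a multiple of \<open>G\<close>, because the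
  line spanned by \<open>G\<close> is what the projection to projective space forgets. As \<open>G\<close> enters
  \<open>\<Phi>\<close> only through \<open>pt\<close>, it may differ from the values of sections in a trivialisation by any
  nonvanishing factor.
\<close>

lemma holo_with_rank_at_homogeneousI:
  fixes G :: "complex^('n::finite option) \<Rightarrow> complex^'r::finite"
    and Par :: "('n option, 'a) params"
  assumes W: "(W, \<psi>) \<in> Par" and S: "open S" "z0 \<in> S" "S \<subseteq> W"
    and \<Phi>: "\<And>z. z \<in> S \<Longrightarrow> \<Phi> (\<psi> z) = (pt (G z), z $ None)"
    and G: "\<And>z j. z \<in> S \<Longrightarrow> \<exists>D. has_cderiv (\<lambda>z. G z $ j) D z"
    and D: "\<And>j. has_cderiv (\<lambda>z. G z $ j) (D j) z0"
    and nz: "G z0 \<noteq> 0"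
    and ker: "\<And>h l. h $ None = 0 \<Longrightarrow> (\<And>j. D j h = l * G z0 $ j) \<Longrightarrow> h = 0"
  shows "holo_with_rank_at Par cproj_times_line_charts \<Phi> (\<psi> z0) CARD('n option)"
proof -
  obtain k where k: "G z0 $ k \<noteq> 0" using nz by (auto simp: vec_eq_iff)
  define R where "R = S \<inter> (\<lambda>z. G z $ k) -` (- {0})"
  have "continuous_on S (\<lambda>z. G z $ k)"
    using has_cderiv_continuous_on[OF G] by (intro continuous_intros)
  then have "open R" unfolding R_def using S(1) by (intro continuous_open_preimage) auto
  have Rnz: "G z $ k \<noteq> 0" if "z \<in> R" for z using that by (simp add: R_def)
  have z0R: "z0 \<in> R" using k S by (simp add: R_def)
  define \<kappa> where "\<kappa> = (\<lambda>(x, t). with_last (affine_coords k x :: complex^'r) (t :: complex))"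
  have chart: "({x. hcoord x $ k \<noteq> 0} \<times> UNIV, \<kappa>) \<in> cproj_times_line_charts"
    unfolding cproj_times_line_charts_def \<kappa>_def cproj_charts_def by blast
  have eq: "(\<kappa> \<circ> \<Phi> \<circ> \<psi>) z = with_last (\<chi> j. G z $ j / G z $ k) (z $ None)" if "z \<in> R" for z
    using that \<Phi>[of z] Rnz[OF that] by (simp add: R_def \<kappa>_def hcoord_pt_nth)
  have der: "\<exists>A. ((\<kappa> \<circ> \<Phi> \<circ> \<psi>) has_derivative (\<lambda>h. A *v h)) (at z) \<and>
      (\<forall>h. A *v h = with_last (\<chi> j. (L j h * G z $ k - G z $ j * L k h) / (G z $ k * G z $ k)) (h $ None))"
    if z: "z \<in> R" and L: "\<And>j. has_cderiv (\<lambda>z. G z $ j) (L j) z" for z L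
  proof -
    define Q where "Q i h = (case i of None \<Rightarrow> h $ None
      | Some j \<Rightarrow> (L j h * G z $ k - G z $ j * L k h) / (G z $ k * G z $ k))"
      for i and h :: "complex^('n option)"
    have Q: "has_cderiv (\<lambda>z. with_last (\<chi> j. G z $ j / G z $ k) (z $ None) $ i) (Q i) z" for i
      using has_cderiv_nth has_cderiv_divide[OF L L Rnz[OF z]]
      unfolding Q_def by (cases i) simp_all
    obtain A where A: "((\<lambda>z. with_last (\<chi> j. G z $ j / G z $ k) (z $ None)) has_derivative (\<lambda>h. A *v h)) (at z)"
      "\<And>h i. (A *v h) $ i = Q i h"
      using has_cderiv_matrix[OF Q] by blast
    have "((\<kappa> \<circ> \<Phi> \<circ> \<psi>) has_derivative (\<lambda>h. A *v h)) (at z)"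
      by (rule has_derivative_transform_within_open[OF A(1) \<open>open R\<close> z]) (rule eq[symmetric])
    moreover have "A *v h = with_last (\<chi> j. (L j h * G z $ k - G z $ j * L k h) / (G z $ k * G z $ k)) (h $ None)" for h
      unfolding vec_eq_iff A(2) Q_def by (auto simp: with_last_def split: option.split)
    ultimately show ?thesis by blast
  qed
  obtain A where A: "((\<kappa> \<circ> \<Phi> \<circ> \<psi>) has_derivative (\<lambda>h. A *v h)) (at z0)"
    "\<And>h. A *v h = with_last (\<chi> j. (D j h * G z0 $ k - G z0 $ j * D k h) / (G z0 $ k * G z0 $ k)) (h $ None)"
    using der[OF z0R D] by blast
  have "rank A = CARD('n option)"
    unfolding full_rank_iff_kernel
  proof (intro allI impI)
    fix h assume "A *v h = 0"
    then have 0: "(A *v h) $ i = 0" for i by simp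
    have "D j h = D k h / G z0 $ k * G z0 $ j" for j
      using 0[of "Some j"] k by (simp add: A(2) field_simps)
    moreover have "h $ None = 0" using 0[of None] by (simp add: A(2))
    ultimately show "h = 0" using ker by blast
  qed
  moreover have "holo_map (\<kappa> \<circ> \<Phi> \<circ> \<psi>) R"
    unfolding holo_map_def
  proof
    fix z assume z: "z \<in> R"
    then obtain L where "\<And>j. has_cderiv (\<lambda>z. G z $ j) (L j) z"
      using G unfolding R_def by (metis IntD1)
    with der[OF z] show "\<exists>A. ((\<kappa> \<circ> \<Phi> \<circ> \<psi>) has_derivative (\<lambda>h. A *v h)) (at z)" by blast
  qed
  moreover have "(\<Phi> \<circ> \<psi>) ` R \<subseteq> {x. hcoord x $ k \<noteq> 0} \<times> UNIV"
    using \<Phi> Rnz by (auto simp: R_def hcoord_pt_nth)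
  ultimately show ?thesis
    unfolding holo_with_rank_at_def using A(1) W chart \<open>open R\<close> z0R S
    by (intro bexI[OF _ W] bexI[OF _ chart] case_prodI bexI[of _ z0] exI[of _ R] exI[of _ A])
      (auto simp: R_def)
qed

section \<open>Points of the family and the values of the map\<close>

lemma glue_map_nth [simp]:
  "glue_map u \<gamma> (x, t) $ None = t"
  "glue_map u \<gamma> (x, t) $ Some i = t powi (- (\<gamma> $ i)) * u x $ i"
  by (auto simp: glue_map_def)

lemma glue_map_inj:
  assumes "inj_on u U"
  shows "inj_on (glue_map u \<gamma>) (U \<times> (- {0}))"
proof (rule inj_onI)
  fix y y' assume y: "y \<in> U \<times> (- {0})" "y' \<in> U \<times> (- {0})" "glue_map u \<gamma> y = glue_map u \<gamma> y'"
  obtain x t x' t' where [simp]: "y = (x, t)" "y' = (x', t')" by (cases y, cases y')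
  have t: "t = t'" using arg_cong[OF y(3), of "\<lambda>z. z $ None"] by simp
  have "u x = u x'"
    unfolding vec_eq_iff
  proof
    fix i
    have "t powi (- (\<gamma> $ i)) * u x $ i = t powi (- (\<gamma> $ i)) * u x' $ i"
      using arg_cong[OF y(3), of "\<lambda>z. z $ Some i"] t by simp
    then show "u x $ i = u x' $ i" using y(1) by simp
  qed
  with assms y t show "y = y'" by (auto dest: inj_onD)
qed

lemma glue_class_Inl:
  assumes "y \<in> X \<times> (- {0})"
  shows "Inl y' \<in> glue_rel X U u \<gamma> `` {Inl y} \<longleftrightarrow> y' = y"
    and "Inr z \<in> glue_rel X U u \<gamma> `` {Inl y} \<longleftrightarrow> y \<in> U \<times> (- {0}) \<and> z = glue_map u \<gamma> y"
  using assms by (auto simp: glue_rel_def Id_on_def pre_family_def)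

text \<open>
  As \<open>glue_map\<close> is injective, no two distinct points of \<open>X \<times> \<complex>\<^sup>*\<close> are glued to each other. Hence each
  class has at most one representative there, and the sections determine the map at all points
  outside the zero fibre.
\<close>

lemma glue_class_Inr:
  assumes "U \<subseteq> X" "inj_on u U" "y \<in> U \<times> (- {0})"
  shows "glue_rel X U u \<gamma> `` {Inr (glue_map u \<gamma> y)} = glue_rel X U u \<gamma> `` {Inl y}"
proof -
  have y: "y \<in> X \<times> (- {0})" "glue_map u \<gamma> y \<in> glue_chart U u \<gamma>"
    using assms by (auto simp: glue_chart_def)
  have "a \<in> glue_rel X U u \<gamma> `` {Inr (glue_map u \<gamma> y)} \<longleftrightarrow> a \<in> glue_rel X U u \<gamma> `` {Inl y}" for a
  proof (cases a)
    case (Inl y')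
    then show ?thesis
      using assms(3) inj_onD[OF glue_map_inj[OF assms(2)], of \<gamma> y y']
      unfolding Inl glue_class_Inl(1)[OF y(1)] by (auto simp: glue_rel_def Id_on_def)
  next
    case (Inr z)
    then show ?thesis
      using assms(3) y unfolding Inr glue_class_Inl(2)[OF y(1)]
      by (auto simp: glue_rel_def Id_on_def pre_family_def)
  qed
  then show ?thesis by blast
qed

lemma glue_class_zero_fibre:
  assumes "z \<in> glue_chart U u \<gamma>" "z $ None = 0"
  shows "glue_rel X U u \<gamma> `` {Inr z} = {Inr z}"
  using assms by (auto simp: glue_rel_def Id_on_def pre_family_def)

lemma family_cases:
  assumes "q \<in> family X U u \<gamma>" "U \<subseteq> X" "inj_on u U"
  obtains (general) x t where "x \<in> X" "t \<noteq> 0" "q = glue_rel X U u \<gamma> `` {Inl (x, t)}"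
  | (zero_fibre) w where "\<And>i. w $ i \<noteq> 0" "q = glue_rel X U u \<gamma> `` {Inr (with_last w 0)}"
proof -
  obtain a where a: "a \<in> pre_family X U u \<gamma>" "q = glue_rel X U u \<gamma> `` {a}"
    using assms(1) unfolding family_def by (rule quotientE)
  show ?thesis
  proof (cases a)
    case (Inl y)
    with a general show ?thesis by (cases y) (auto simp: pre_family_def)
  next
    case (Inr z)
    with a(1) consider y where "y \<in> U \<times> (- {0})" "z = glue_map u \<gamma> y"
      | w where "\<forall>i. w $ i \<noteq> 0" "z = with_last w 0"
      by (auto simp: pre_family_def glue_chart_def)
    then show ?thesis
    proof cases
      case 1
      then have "q = glue_rel X U u \<gamma> `` {Inl y}"
        using a(2) Inr glue_class_Inr[OF assms(2,3)] by simp
      with 1(1) assms(2) general show ?thesis by (cases y) auto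
    next
      case 2
      with a(2) Inr zero_fibre show ?thesis by auto
    qed
  qed
qed

lemma family_map_general:
  assumes "x \<in> X" "t \<noteq> 0"
  shows "family_map T \<gamma> \<eta> \<beta> c (glue_rel X U u \<gamma> `` {Inl (x, t)}) =
    (pt (\<chi> j. t powi (- wdot \<gamma> (\<beta> j)) * sval T (\<eta> j) x), t)"
proof -
  define q where "q = glue_rel X U u \<gamma> `` {Inl (x, t)}"
  have xt: "(x, t) \<in> X \<times> (- {0})" using assms by simp
  note cls = glue_class_Inl[OF xt, of _ U u \<gamma>, folded q_def]
  have "family_coords T \<gamma> \<eta> \<beta> c q = (\<chi> j. t powi (- wdot \<gamma> (\<beta> j)) * sval T (\<eta> j) x)"
    unfolding family_coords_def cls(1) by simp
  moreover have "(\<lambda>a. case a of Inl y \<Rightarrow> snd y | Inr z \<Rightarrow> z $ None) ` q = {t}"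
  proof
    have "(case a of Inl y \<Rightarrow> snd y | Inr z \<Rightarrow> z $ None) = t" if "a \<in> q" for a
      using that by (cases a) (auto simp: cls)
    then show "(\<lambda>a. case a of Inl y \<Rightarrow> snd y | Inr z \<Rightarrow> z $ None) ` q \<subseteq> {t}" by blast
    have "Inl (x, t) \<in> q" by (simp add: cls)
    then show "{t} \<subseteq> (\<lambda>a. case a of Inl y \<Rightarrow> snd y | Inr z \<Rightarrow> z $ None) ` q" by force
  qed
  ultimately show ?thesis by (simp add: family_map_def family_proj_def flip: q_def)
qed

lemma family_map_zero_fibre:
  assumes "z \<in> glue_chart U u \<gamma>" "z $ None = 0"
  shows "family_map T \<gamma> \<eta> \<beta> c (glue_rel X U u \<gamma> `` {Inr z}) =
    (pt (\<chi> j. \<Sum>\<^sub>\<infinity>\<alpha>\<in>nonneg_vecs.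
        c j \<alpha> * monom_vec (but_last z) \<alpha> * z $ None powi (wdot \<gamma> \<alpha> - wdot \<gamma> (\<beta> j))), z $ None)"
  unfolding glue_class_zero_fibre[OF assms]
  by (simp add: family_map_def family_proj_def family_coords_def)

section \<open>The Kodaira map in coordinates\<close>

lemma holo_with_rank_atE:
  assumes "holo_with_rank_at Par Ch f x k"
  obtains W \<psi> V \<kappa> y S A where "(W, \<psi>) \<in> Par" "(V, \<kappa>) \<in> Ch" "\<psi> y = x" "open S" "y \<in> S" "S \<subseteq> W"
    "(f \<circ> \<psi>) ` S \<subseteq> V" "holo_map (\<kappa> \<circ> f \<circ> \<psi>) S"
    "((\<kappa> \<circ> f \<circ> \<psi>) has_derivative (\<lambda>h. A *v h)) (at y)" "rank A = k"
  using assms unfolding holo_with_rank_at_def by (elim bexE case_prodE exE conjE) simp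

text \<open>
  At each point \<open>sval\<close> uses one trivialisation for all sections, so a linear relation between
  sections holds between their values with the same coefficients at all points.
\<close>

lemma sval_span:
  fixes b :: "'r::finite \<Rightarrow> ('i, 'm::finite) lsection"
  assumes "\<sigma> \<in> sec.span (range b)"
  shows "\<exists>M. \<forall>x. sval T \<sigma> x = (\<Sum>l\<in>UNIV. M l * sval T (b l) x)"
  using assms
proof (induction rule: sec.span_induct_alt)
  case base
  show ?case by (rule exI[of _ "\<lambda>_. 0"]) (simp add: sval_def)
next
  case (step a \<rho> \<sigma>)
  then obtain M l where "\<forall>x. sval T \<sigma> x = (\<Sum>l\<in>UNIV. M l * sval T (b l) x)" "\<rho> = b l" by blast
  then have "sval T (sscale a \<rho> + \<sigma>) x = (\<Sum>k\<in>UNIV. (M k + (if k = l then a else 0)) * sval T (b k) x)" for x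
    by (simp add: distrib_right sum.distrib mult_delta_left sval_def sscale_def)
  then show ?case by (intro exI[of _ "\<lambda>k. M k + (if k = l then a else 0)"] allI)
qed

lemma basis_change:
  fixes b \<eta> :: "'r::finite \<Rightarrow> ('i, 'm::finite) lsection"
  assumes "basis_of E b" "basis_of E \<eta>"
  obtains M where "\<And>j x. sval T (\<eta> j) x = (\<Sum>l\<in>UNIV. M j l * sval T (b l) x)"
proof -
  have "\<eta> j \<in> sec.span (range b)" for j
    using assms sec.span_superset[of "range \<eta>"] by (auto simp: basis_of_def)
  then have "\<exists>M. \<forall>x. sval T (\<eta> j) x = (\<Sum>l\<in>UNIV. M l * sval T (b l) x)" for j
    by (rule sval_span)
  then show thesis using that by metis
qed

lemma kodaira_chart_coords:
  assumes b: "\<And>j. b j \<in> E"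
    and V: "kodaira_map T E x \<in> {q \<in> dual_proj E. \<forall>l\<in>q. l (b i) \<noteq> 0}"
  shows "sval T (b i) x \<noteq> 0"
    and "(SOME l. l \<in> kodaira_map T E x) (b j) / (SOME l. l \<in> kodaira_map T E x) (b i) =
      sval T (b j) x / sval T (b i) x"
proof -
  have ev: "(\<lambda>\<sigma>. 1 * (if \<sigma> \<in> E then sval T \<sigma> x else 0)) \<in> kodaira_map T E x"
    unfolding kodaira_map_def by force
  with V b show nz: "sval T (b i) x \<noteq> 0" by fastforce
  have "(SOME l. l \<in> kodaira_map T E x) \<in> kodaira_map T E x"
    by (rule someI[of "\<lambda>l. l \<in> kodaira_map T E x", OF ev])
  then obtain a where "a \<noteq> 0"
    "(SOME l. l \<in> kodaira_map T E x) = (\<lambda>\<sigma>. a * (if \<sigma> \<in> E then sval T \<sigma> x else 0))"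
    unfolding kodaira_map_def by blast
  with b nz show "(SOME l. l \<in> kodaira_map T E x) (b j) / (SOME l. l \<in> kodaira_map T E x) (b i) =
      sval T (b j) x / sval T (b i) x" by simp
qed

text \<open>
  The hypothesis is an immersion in the chart of one basis \<open>b\<close> normalised by one \<open>b\<^sub>i\<close>; the conclusion
  is about local expressions \<open>e\<^sub>j\<close> of another basis \<open>\<eta>\<close>, up to a common factor \<open>v\<close>. With
  \<open>B\<^sub>l = b\<^sub>l / b\<^sub>i\<close>, a relation \<open>de (h) = \<lambda> e\<close> is transported to \<open>dB (h) = \<lambda> B\<close> by the base
  change. The component \<open>B\<^sub>i = 1\<close> is constant, which forces \<open>\<lambda> = 0\<close>, and then \<open>h = 0\<close> as \<open>dB\<close> is injective.
  So the affine cone over the image is immersed, and not only the image.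
\<close>

lemma kodaira_local_coords:
  fixes X :: "'m::finite cproj set" and Par :: "('n::finite, 'm cproj) params"
    and \<eta> :: "'r::finite \<Rightarrow> ('i, 'm) lsection"
  assumes kod: "kodaira_embedding TYPE('r) Par X T E" and "basis_of E \<eta>" "x \<in> X"
  obtains W \<psi> S y v e D where "(W, \<psi>) \<in> Par" "open S" "S \<subseteq> W" "y \<in> S" "\<psi> y = x"
    and "\<forall>y\<in>S. v y \<noteq> 0"
    and "\<forall>y\<in>S. \<forall>j. sval T (\<eta> j) (\<psi> y) = v y * e j y"
    and "\<forall>y\<in>S. \<forall>j. \<exists>L. has_cderiv (e j) L y"
    and "\<forall>j. has_cderiv (e j) (D j) y"
    and "\<forall>y\<in>S. \<exists>j. e j y \<noteq> 0"
    and "\<forall>h l. (\<forall>j. D j h = l * e j y) \<longrightarrow> h = 0"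
proof -
  have "holo_with_rank_at Par (dual_proj_charts E :: (_, 'r) charts) (kodaira_map T E) x CARD('n)"
    using kod \<open>x \<in> X\<close> by (simp add: kodaira_embedding_def holomorphic_immersion_def)
  then obtain W \<psi> V \<kappa> y S and A :: "complex^'n^'r" where
    par: "(W, \<psi>) \<in> Par" and chart: "(V, \<kappa>) \<in> (dual_proj_charts E :: (_, 'r) charts)"
    and y: "\<psi> y = x" "open S" "y \<in> S" "S \<subseteq> W" "(kodaira_map T E \<circ> \<psi>) ` S \<subseteq> V"
    and holo: "holo_map (\<kappa> \<circ> kodaira_map T E \<circ> \<psi>) S"
    and A: "((\<kappa> \<circ> kodaira_map T E \<circ> \<psi>) has_derivative (\<lambda>h. A *v h)) (at y)" "rank A = CARD('n)"
    by (rule holo_with_rank_atE)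
  from chart obtain b :: "'r \<Rightarrow> _" and i where b: "basis_of E b"
    and V: "V = {q \<in> dual_proj E. \<forall>l\<in>q. l (b i) \<noteq> 0}"
    and \<kappa>: "\<kappa> = (\<lambda>q. \<chi> j. (SOME l. l \<in> q) (b j) / (SOME l. l \<in> q) (b i))"
    unfolding dual_proj_charts_def by blast
  have bE: "b j \<in> E" for j
    using b sec.span_superset[of "range b"] by (auto simp: basis_of_def)
  define B where "B = \<kappa> \<circ> kodaira_map T E \<circ> \<psi>"
  define v where "v y = sval T (b i) (\<psi> y)" for y
  have v: "v z \<noteq> 0" and B: "sval T (b j) (\<psi> z) = v z * B z $ j" if "z \<in> S" for z j
  proof -
    have *: "kodaira_map T E (\<psi> z) \<in> {q \<in> dual_proj E. \<forall>l\<in>q. l (b i) \<noteq> 0}"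
      using y(5) that V by auto
    show nz: "v z \<noteq> 0" unfolding v_def by (rule kodaira_chart_coords(1)[where b = b and i = i, OF bE *])
    show "sval T (b j) (\<psi> z) = v z * B z $ j"
      using nz kodaira_chart_coords(2)[where b = b and i = i, OF bE *, of j] by (simp add: B_def \<kappa> v_def)
  qed
  obtain M where M: "\<And>j x. sval T (\<eta> j) x = (\<Sum>l\<in>UNIV. M j l * sval T (b l) x)"
    using basis_change[OF b assms(2)] by blast
  obtain N where N: "\<And>j x. sval T (b j) x = (\<Sum>l\<in>UNIV. N j l * sval T (\<eta> l) x)"
    using basis_change[OF assms(2) b] by blast
  define e where "e j z = (\<Sum>l\<in>UNIV. M j l * B z $ l)" for j z
  have e: "sval T (\<eta> j) (\<psi> z) = v z * e j z" if "z \<in> S" for j z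
    using that by (simp add: M e_def B sum_distrib_left algebra_simps)
  have Be: "B z $ l = (\<Sum>j\<in>UNIV. N l j * e j z)" if "z \<in> S" for l z
  proof -
    have "v z * B z $ l = v z * (\<Sum>j\<in>UNIV. N l j * e j z)"
      using that by (simp add: B[symmetric] N e sum_distrib_left algebra_simps)
    with v[OF that] show ?thesis by simp
  qed
  have Bi: "B z $ i = 1" if "z \<in> S" for z
    using B[OF that, of i] v[OF that] by (simp add: v_def)
  define D where "D j h = (\<Sum>l\<in>UNIV. M j l * (A *v h) $ l)" for j h
  have DB: "has_cderiv (\<lambda>z. B z $ l) (\<lambda>h. (A *v h) $ l) y" for l
    using A(1) unfolding B_def by (rule matrix_has_cderiv)
  have De: "has_cderiv (e j) (D j) y" for j
    unfolding e_def[abs_def] D_def[abs_def] by (intro has_cderiv_sum DB)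
  \<comment> \<open>Since \<open>B = N e\<close> near \<open>y\<close>, uniqueness of the derivative stands in for inverting the base change.\<close>
  have AD: "(A *v h) $ l = (\<Sum>j\<in>UNIV. N l j * D j h)" for l h
  proof -
    have "has_cderiv (\<lambda>z. B z $ l) (\<lambda>h. \<Sum>j\<in>UNIV. N l j * D j h) y"
      by (rule has_cderiv_transform[OF has_cderiv_sum[OF De] y(2,3)]) (simp add: Be)
    from has_cderiv_unique[OF DB this] show ?thesis by meson
  qed
  have Ai: "(A *v h) $ i = 0" for h
  proof -
    have "has_cderiv (\<lambda>z. B z $ i) (\<lambda>h. 0) y"
      by (rule has_cderiv_transform[OF _ y(2,3), of "\<lambda>_. 1"]) (simp_all add: Bi has_cderiv_def)
    from has_cderiv_unique[OF DB this] show ?thesis by meson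
  qed
  show thesis
  proof
    show "(W, \<psi>) \<in> Par" "open S" "S \<subseteq> W" "y \<in> S" "\<psi> y = x" using par y by auto
    show "\<forall>z\<in>S. v z \<noteq> 0" using v by blast
    show "\<forall>z\<in>S. \<forall>j. sval T (\<eta> j) (\<psi> z) = v z * e j z" using e by blast
    show "\<forall>z\<in>S. \<forall>j. \<exists>L. has_cderiv (e j) L z"
    proof (intro ballI allI)
      fix z j assume z: "z \<in> S"
      obtain A' where A': "(B has_derivative (\<lambda>h. A' *v h)) (at z)"
        using holo z unfolding holo_map_def B_def by blast
      show "\<exists>L. has_cderiv (e j) L z"
        unfolding e_def[abs_def] by (rule exI) (rule has_cderiv_sum[OF matrix_has_cderiv[OF A']])
    qed
    show "\<forall>j. has_cderiv (e j) (D j) y" using De by blast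
    show "\<forall>z\<in>S. \<exists>j. e j z \<noteq> 0"
    proof
      fix z assume z: "z \<in> S"
      show "\<exists>j. e j z \<noteq> 0" using Be[OF z, of i] Bi[OF z] by (intro ccontr[of "\<exists>j. _ j"]) simp
    qed
    show "\<forall>h l. (\<forall>j. D j h = l * e j y) \<longrightarrow> h = 0"
    proof (intro allI impI)
      fix h l assume l: "\<forall>j. D j h = l * e j y"
      have Al: "(A *v h) $ k = l * B y $ k" for k
        by (simp add: AD Be[OF y(3)] l sum_distrib_left algebra_simps)
      have "l = 0" using Al[of i] Ai[of h] Bi[OF y(3)] by simp
      with Al have "A *v h = 0" by (simp add: vec_eq_iff)
      with A(2) show "h = 0" by (simp add: full_rank_iff_kernel)
    qed
  qed
qed

section \<open>The immersion property away from the zero fibre\<close>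

lemma but_last_nth [simp]: "but_last z $ i = z $ Some i"
  by (simp add: but_last_def)

lemma bounded_linear_but_last: "bounded_linear (but_last :: complex^('n::finite option) \<Rightarrow> _)"
  by (intro linear_linear[THEN iffD2] linearI) (auto simp: vec_eq_iff)

lemma vec_option_eqI:
  assumes "z $ None = z' $ None" "but_last z = but_last z'"
  shows "z = z'"
proof -
  have "z $ Some i = z' $ Some i" for i
    using arg_cong[OF assms(2), of "\<lambda>w. w $ i"] by simp
  with assms(1) show ?thesis by (auto simp: vec_eq_iff split_option_all)
qed

lemma local_params_image:
  assumes "(W, \<psi>) \<in> local_params X"
  shows "\<psi> ` W \<subseteq> X"
proof -
  have "openin (top_of_set X) (\<psi> ` W)" using assms unfolding local_params_def by blast
  from openin_subset[OF this] show ?thesis by simp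
qed

text \<open>
  For fixed \<open>t \<noteq> 0\<close> the powers of \<open>t\<close> act on the homogeneous coordinates by an invertible diagonal
  matrix, so the relation \<open>dG (h) = \<lambda> G\<close> along the fibre is equivalent to the same relation for the
  Kodaira map.
\<close>

lemma family_map_immersive_general:
  fixes X U :: "'m::finite cproj set" and u :: "'m cproj \<Rightarrow> complex^'n::finite"
    and \<eta> :: "'r::finite \<Rightarrow> ('i, 'm) lsection"
  assumes kod: "kodaira_embedding TYPE('r) (local_params X :: ('n, 'm cproj) params) X T E"
    and \<eta>: "basis_of E \<eta>" and x: "x \<in> X" and t: "t \<noteq> 0"
  shows "holo_with_rank_at (family_params X U u \<gamma>) cproj_times_line_charts
    (family_map T \<gamma> \<eta> \<beta> c) (glue_rel X U u \<gamma> `` {Inl (x, t)}) CARD('n option)"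
proof -
  obtain W \<psi> S y v e D where par: "(W, \<psi>) \<in> (local_params X :: ('n, 'm cproj) params)"
    and S: "open S" "S \<subseteq> W" "y \<in> S" "\<psi> y = x"
    and v: "\<forall>y\<in>S. v y \<noteq> 0"
    and e: "\<forall>y\<in>S. \<forall>j. sval T (\<eta> j) (\<psi> y) = v y * e j y"
    and holo: "\<forall>y\<in>S. \<forall>j. \<exists>L. has_cderiv (e j) L y"
    and D: "\<forall>j. has_cderiv (e j) (D j) y"
    and nz: "\<forall>y\<in>S. \<exists>j. e j y \<noteq> 0"
    and ker: "\<forall>h l. (\<forall>j. D j h = l * e j y) \<longrightarrow> h = 0"
    by (rule kodaira_local_coords[OF kod \<eta> x])
  define k where "k j = - wdot \<gamma> (\<beta> j)" for j
  define G where "G z = (\<chi> j. (z $ None) powi k j * e j (but_last z))" for z :: "complex^('n option)"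
  define S' where "S' = {z :: complex^('n option). but_last z \<in> S} \<inter> {z. z $ None \<noteq> 0}"
  define \<psi>' where "\<psi>' z = glue_rel X U u \<gamma> `` {Inl (\<psi> (but_last z), z $ None)}" for z
  have deriv: "has_cderiv (\<lambda>z. G z $ j) (\<lambda>h. (z $ None) powi k j * L (but_last h)
      + of_int (k j) * (z $ None) powi (k j - 1) * (h $ None) * e j (but_last z)) z"
    if "z \<in> S'" "has_cderiv (e j) L (but_last z)" for z j L
  proof -
    have 1: "has_cderiv (\<lambda>z. (z $ None) powi k j) (\<lambda>h. (of_int (k j) * (z $ None) powi (k j - 1)) * h $ None) z"
      using that(1) by (intro has_cderiv_field_comp[OF _ has_cderiv_nth])
        (auto intro!: derivative_eq_intros simp: S'_def)
    have 2: "has_cderiv (\<lambda>z. e j (but_last z)) (\<lambda>h. L (but_last h)) z"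
      using that(2) bounded_linear_but_last by (rule has_cderiv_matrix_comp) (simp add: vec_eq_iff)
    from has_cderiv_mult[OF 1 2] show ?thesis by (simp add: G_def)
  qed
  have Gnz: "G z \<noteq> 0" if "z \<in> S'" for z
    using bspec[OF nz, of "but_last z"] that by (auto simp: G_def S'_def vec_eq_iff)
  have z0: "but_last (with_last y t) = y" by (simp add: vec_eq_iff)
  have z0S: "with_last y t \<in> S'" using S(3) t by (simp add: S'_def z0)
  have "holo_with_rank_at (family_params X U u \<gamma>) cproj_times_line_charts
    (family_map T \<gamma> \<eta> \<beta> c) (\<psi>' (with_last y t)) CARD('n option)"
  proof (rule holo_with_rank_at_homogeneousI[where W = "{z. but_last z \<in> W \<and> z $ None \<noteq> 0}" and S = S' and G = G])
    show "({z. but_last z \<in> W \<and> z $ None \<noteq> 0}, \<psi>') \<in> family_params X U u \<gamma>"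
      unfolding family_params_def \<psi>'_def[abs_def] using par by blast
    show "open S'"
      unfolding S'_def
      using open_vimage[OF S(1) linear_continuous_on[OF bounded_linear_but_last]]
      by (intro open_Int open_Collect_neq continuous_intros) (simp add: vimage_def)
    show "with_last y t \<in> S'" by (rule z0S)
    show "S' \<subseteq> {z. but_last z \<in> W \<and> z $ None \<noteq> 0}" using S(2) by (auto simp: S'_def)
    show "family_map T \<gamma> \<eta> \<beta> c (\<psi>' z) = (pt (G z), z $ None)" if z: "z \<in> S'" for z
    proof -
      have zS: "but_last z \<in> S" "z $ None \<noteq> 0" using z by (auto simp: S'_def)
      have "\<psi> (but_last z) \<in> X"
        using zS(1) S(2) local_params_image[OF par] by blast
      then have "family_map T \<gamma> \<eta> \<beta> c (\<psi>' z) = (pt (v (but_last z) *s G z), z $ None)"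
        using zS unfolding \<psi>'_def
        by (subst family_map_general) (auto simp: G_def k_def e vec_eq_iff intro!: arg_cong[of _ _ pt])
      moreover have "pt (v (but_last z) *s G z) = pt (G z)"
        using v zS(1) Gnz[OF z] by (intro pt_scale) auto
      ultimately show ?thesis by simp
    qed
    show "\<exists>D. has_cderiv (\<lambda>z. G z $ j) D z" if "z \<in> S'" for z j
    proof -
      have "but_last z \<in> S" using that by (simp add: S'_def)
      then obtain L where "has_cderiv (e j) L (but_last z)" using holo by blast
      from deriv[OF that this] show ?thesis by blast
    qed
    show "has_cderiv (\<lambda>z. G z $ j) (\<lambda>h. t powi k j * D j (but_last h)
      + of_int (k j) * t powi (k j - 1) * (h $ None) * e j y) (with_last y t)" for j
      using deriv[OF z0S, of j "D j"] D by (simp add: z0)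
    show "G (with_last y t) \<noteq> 0"
      by (rule Gnz[OF z0S])
    show "h = 0" if "h $ None = 0" and h: "\<And>j. t powi k j * D j (but_last h)
      + of_int (k j) * t powi (k j - 1) * (h $ None) * e j y = l * G (with_last y t) $ j" for h l
    proof -
      have "D j (but_last h) = l * e j y" for j
        using h[of j] t \<open>h $ None = 0\<close> by (simp add: G_def z0)
      then have "but_last h = 0" using ker by blast
      with \<open>h $ None = 0\<close> show ?thesis by (intro vec_option_eqI) (simp_all add: vec_eq_iff)
    qed
  qed
  then show ?thesis using S(4) by (simp add: \<psi>'_def z0)
qed

section \<open>Lattices and monomials\<close>

text \<open>
  A linear form that is constant on \<open>A\<close> vanishes on the differences, hence on the lattice that they generate.
\<close>

lemma differences_generate_separates:
  fixes A :: "(int^'n::finite) set" and k :: "'n \<Rightarrow> complex"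
  assumes gen: "differences_generate A"
    and const: "\<And>a. a \<in> A \<Longrightarrow> (\<Sum>i\<in>UNIV. of_int (a $ i) * k i) = s"
  shows "k i = 0"
proof -
  interpret int_vec: module "(*s) :: int \<Rightarrow> int^'n \<Rightarrow> int^'n"
    by unfold_locales (auto simp: vec_eq_iff algebra_simps)
  define K where "K = {a :: int^'n. (\<Sum>i\<in>UNIV. of_int (a $ i) * k i) = 0}"
  have "int_vec.subspace K"
    unfolding int_vec.subspace_def K_def
    by (auto simp: algebra_simps sum.distrib sum_distrib_left[symmetric])
  moreover have "{a - b | a b. a \<in> A \<and> b \<in> A} \<subseteq> K"
    using const by (auto simp: K_def left_diff_distrib sum_subtractf)
  ultimately have "K = UNIV"
    using gen int_vec.span_minimal unfolding differences_generate_def by blast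
  then have "axis i 1 \<in> K" by simp
  moreover have "of_int (axis i 1 $ l) * k l = (if l = i then k i else 0)" for l
    by (simp add: axis_def)
  ultimately show ?thesis by (simp add: K_def)
qed

lemma prod_UNIV_option:
  fixes f :: "'n::finite option \<Rightarrow> 'a::comm_monoid_mult"
  shows "prod f UNIV = f None * (\<Prod>i\<in>UNIV. f (Some i))"
  by (simp add: UNIV_option_conv prod.reindex)

lemma power_int_prod_sum:
  fixes t :: complex
  assumes "t \<noteq> 0"
  shows "(\<Prod>i\<in>I. t powi f i) = t powi (\<Sum>i\<in>I. f i)"
  using assms by (induction I rule: infinite_finite_induct) (auto simp: power_int_add)

text \<open>
  This identity is why the gluing by \<open>t powi (- \<gamma>)\<close> turns \<open>f\<^sub>j\<close> into a series in \<open>(w, t)\<close>: substituting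
  \<open>u = t\<^sup>\<gamma> w\<close> produces the exponents \<open>\<gamma> \<cdot> \<alpha>\<close> of \<open>t\<close>.
\<close>

lemma monom_vec_weighted:
  assumes "t \<noteq> 0"
  shows "monom_vec (\<chi> i. t powi (\<gamma> $ i) * w $ i) \<alpha> = t powi wdot \<gamma> \<alpha> * monom_vec w \<alpha>"
  using assms
  by (simp add: monom_vec_def wdot_def power_int_mult_distrib prod.distrib power_int_prod_sum
      flip: power_int_mult)

lemma monom_vec_nat:
  assumes "\<alpha> \<in> nonneg_vecs"
  shows "monom_vec w \<alpha> = (\<Prod>i\<in>UNIV. w $ i ^ nat (\<alpha> $ i))"
  using assms by (auto simp: monom_vec_def nonneg_vecs_def power_int_def intro!: prod.cong)

section \<open>Neighbourhoods in the variety\<close>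

text \<open>
  A parametrisation is by definition an open map whose composition with affine coordinates is
  holomorphic; continuity into the quotient topology of projective space is recovered by
  taking the affine coordinates as a local lift to \<open>\<complex>\<^sup>m - {0}\<close>.
\<close>

lemma local_params_continuous:
  assumes par: "(W, \<psi>) \<in> local_params X" and Q: "open Q"
  shows "open {y \<in> W. \<psi> y \<in> Q}"
proof (subst open_subopen, intro ballI)
  fix x assume "x \<in> {y \<in> W. \<psi> y \<in> Q}"
  then have x: "x \<in> W" "\<psi> x \<in> Q" by auto
  have "holomorphic_immersion {(W, id)} cproj_charts W \<psi>"
    using par unfolding local_params_def by simp
  then have "holo_with_rank_at {(W, id)} cproj_charts \<psi> x CARD('a)"
    using x unfolding holomorphic_immersion_def by blast
  then obtain W' \<psi>' V \<kappa> y S A where 1: "(W', \<psi>') \<in> {(W, id)}" "(V, \<kappa>) \<in> cproj_charts"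
    "\<psi>' y = x" "open S" "y \<in> S" "S \<subseteq> W'" "(\<psi> \<circ> \<psi>') ` S \<subseteq> V" "holo_map (\<kappa> \<circ> \<psi> \<circ> \<psi>') S"
    by (rule holo_with_rank_atE)
  obtain i where V: "V = {x. hcoord x $ i \<noteq> 0}" and \<kappa>: "\<kappa> = affine_coords i"
    using 1(2) unfolding cproj_charts_def by blast
  have S: "x \<in> S" "S \<subseteq> W" "\<And>z. z \<in> S \<Longrightarrow> hcoord (\<psi> z) $ i \<noteq> 0"
    and cont: "continuous_on S (affine_coords i \<circ> \<psi>)"
    using 1 holo_map_continuous_on[OF 1(8)] V \<kappa> by auto
  define R where "R = S \<inter> (affine_coords i \<circ> \<psi>) -` {v. v \<noteq> 0 \<and> pt v \<in> Q}"
  have "open R"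
    unfolding R_def using Q cont 1(4) by (intro continuous_open_preimage) (auto simp: open_cproj_def)
  moreover have "z \<in> R \<longleftrightarrow> \<psi> z \<in> Q" if "z \<in> S" for z
  proof -
    have "affine_coords i (\<psi> z) $ i = 1" using S(3)[OF that] by (simp add: affine_coords_def)
    then have "affine_coords i (\<psi> z) \<noteq> 0" by auto
    then show ?thesis using that S(3)[OF that] by (simp add: R_def pt_affine_coords)
  qed
  ultimately show "\<exists>R. open R \<and> x \<in> R \<and> R \<subseteq> {y \<in> W. \<psi> y \<in> Q}"
    using x S by (intro exI[of _ R]) (auto simp: R_def)
qed

lemma polydisc_in_open:
  fixes N :: "(complex^'n::finite) set"
  assumes "open N" "0 \<in> N"
  obtains \<rho> where "\<rho> > 0" "\<And>z. (\<And>i. norm (z $ i) \<le> \<rho>) \<Longrightarrow> z \<in> N"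
proof -
  obtain d where d: "d > 0" "cball 0 d \<subseteq> N"
    using assms open_contains_cball by blast
  show thesis
  proof
    show "d / CARD('n) > 0" using d by simp
    fix z :: "complex^'n" assume z: "\<And>i. norm (z $ i) \<le> d / CARD('n)"
    have "norm z \<le> (\<Sum>i\<in>UNIV. norm (z $ i))"
      unfolding norm_vec_def by (rule L2_set_le_sum) simp
    also have "\<dots> \<le> d" using sum_bounded_above[of UNIV "\<lambda>i. norm (z $ i)" "d / CARD('n)"] z by simp
    finally show "z \<in> N" using d by auto
  qed
qed

text \<open>
  The finitely many expansions at \<open>p\<close> are valid near \<open>p\<close> in the topology of \<open>X\<close>. In the coordinates
  \<open>u\<close> they hold on a common polydisc because the inverse of \<open>u\<close> is continuous. The polydisc is closed so that
  it contains its corner \<open>(\<rho>, \<dots>, \<rho>)\<close>, where convergence majorises the series on all of it.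
\<close>

lemma power_series_neighbourhood:
  fixes u :: "'m::finite cproj \<Rightarrow> complex^'n::finite" and f :: "'r::finite \<Rightarrow> 'm cproj \<Rightarrow> complex"
  assumes U: "openin (top_of_set X) U" "p \<in> U" "biholomorphic_on X U u" and p: "u p = 0"
    and c: "\<And>j. power_series_at X u p (f j) (c j)"
  obtains \<rho> where "\<rho> > 0"
    and "\<forall>y. (\<forall>i. norm (y $ i) \<le> \<rho>) \<longrightarrow> (\<exists>x\<in>U. u x = y \<and>
      (\<forall>j. ((\<lambda>\<alpha>. c j \<alpha> * monom_vec y \<alpha>) has_sum f j x) nonneg_vecs))"
proof -
  have "\<forall>j. \<exists>W. openin (top_of_set X) W \<and> p \<in> W \<and>
      (\<forall>x\<in>W. ((\<lambda>\<alpha>. c j \<alpha> * monom_vec (u x) \<alpha>) has_sum f j x) nonneg_vecs)"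
    using c unfolding power_series_at_def by blast
  then obtain W where W: "\<And>j. openin (top_of_set X) (W j)" "\<And>j. p \<in> W j"
    "\<And>j x. x \<in> W j \<Longrightarrow> ((\<lambda>\<alpha>. c j \<alpha> * monom_vec (u x) \<alpha>) has_sum f j x) nonneg_vecs"
    by metis
  have "\<forall>j. \<exists>Q. open Q \<and> W j = X \<inter> Q" using W(1) by (simp add: openin_open)
  then obtain Q where Q: "\<And>j. open (Q j)" "\<And>j. W j = X \<inter> Q j" by metis
  define \<psi> where "\<psi> = inv_into U u"
  have inj: "inj_on u U" and par: "(u ` U, \<psi>) \<in> local_params X"
    using U(3) by (auto simp: biholomorphic_on_def \<psi>_def)
  have UX: "U \<subseteq> X" using openin_subset[OF U(1)] by simp
  define N where "N = {y \<in> u ` U. \<psi> y \<in> (\<Inter>j. Q j)}"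
  have "open N"
    unfolding N_def using Q(1) by (intro local_params_continuous[OF par] open_INT) auto
  moreover have "0 \<in> N"
    using U(2) W(2) inj Q(2) unfolding N_def \<psi>_def p[symmetric] by auto
  ultimately obtain \<rho> where \<rho>: "\<rho> > 0" "\<And>z. (\<And>i. norm (z $ i) \<le> \<rho>) \<Longrightarrow> z \<in> N"
    using polydisc_in_open by blast
  show thesis
  proof
    show "\<rho> > 0" by (rule \<rho>(1))
    show "\<forall>y. (\<forall>i. norm (y $ i) \<le> \<rho>) \<longrightarrow> (\<exists>x\<in>U. u x = y \<and>
      (\<forall>j. ((\<lambda>\<alpha>. c j \<alpha> * monom_vec y \<alpha>) has_sum f j x) nonneg_vecs))"
    proof (intro allI impI)
      fix y :: "complex^'n" assume "\<forall>i. norm (y $ i) \<le> \<rho>"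
      then have "y \<in> N" using \<rho>(2) by blast
      then obtain x where x: "x \<in> U" "y = u x" "\<forall>j. x \<in> Q j"
        using inj by (auto simp: N_def \<psi>_def)
      then have "x \<in> W j" for j using Q(2) UX by auto
      with x W(3) show "\<exists>x\<in>U. u x = y \<and>
        (\<forall>j. ((\<lambda>\<alpha>. c j \<alpha> * monom_vec y \<alpha>) has_sum f j x) nonneg_vecs)" by blast
    qed
  qed
qed

section \<open>The rescaled power series near the zero fibre\<close>

text \<open>
  The rule for differentiating integer powers needs a nonzero base, hence the exponents \<open>\<alpha>\<close> and
  \<open>\<gamma> \<cdot> \<alpha> - \<gamma> \<cdot> b\<close> of the series in \<open>(w, t)\<close> are encoded as natural numbers. When \<open>b\<close> has the least
  weight in the support, truncation affects only indices \<open>\<alpha>\<close> whose coefficient is zero.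
\<close>

definition family_exponent :: "int^'n::finite \<Rightarrow> int^'n \<Rightarrow> int^'n \<Rightarrow> 'n option \<Rightarrow> nat" where
  "family_exponent \<gamma> b \<alpha> k =
     (case k of None \<Rightarrow> nat (wdot \<gamma> \<alpha> - wdot \<gamma> b) | Some i \<Rightarrow> nat (\<alpha> $ i))"

definition family_series ::
  "int^'n::finite \<Rightarrow> int^'n \<Rightarrow> (int^'n \<Rightarrow> complex) \<Rightarrow> complex^('n option) \<Rightarrow> complex" where
  "family_series \<gamma> b a z =
     (\<Sum>\<^sub>\<infinity>\<alpha>\<in>nonneg_vecs. a \<alpha> * (\<Prod>k\<in>UNIV. z $ k ^ family_exponent \<gamma> b \<alpha> k))"

lemma wdot_nonneg:
  assumes "\<And>i. \<gamma> $ i > 0" "\<alpha> \<in> nonneg_vecs"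
  shows "wdot \<gamma> \<alpha> \<ge> (\<Sum>i\<in>UNIV. \<alpha> $ i)" "wdot \<gamma> \<alpha> \<ge> 0"
proof -
  have "\<alpha> $ i \<le> \<gamma> $ i * \<alpha> $ i" "\<alpha> $ i \<ge> 0" for i
    using assms(1)[of i] assms(2) mult_right_mono[of 1 "\<gamma> $ i" "\<alpha> $ i"] by (auto simp: nonneg_vecs_def)
  then show "wdot \<gamma> \<alpha> \<ge> (\<Sum>i\<in>UNIV. \<alpha> $ i)" "wdot \<gamma> \<alpha> \<ge> 0"
    unfolding wdot_def by (intro sum_mono sum_nonneg; meson order_trans)+
qed

text \<open>
  Here \<open>a\<close> is the coefficient family of one \<open>f\<^sub>j\<close> and \<open>b\<close> its valuation, the unique point of the support with
  the least weight.
\<close>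

locale weighted_series =
  fixes \<gamma> b :: "int^'n::finite" and a :: "int^'n \<Rightarrow> complex"
  assumes \<gamma>: "\<And>i. \<gamma> $ i > 0"
    and supp_nonneg: "supp a \<subseteq> nonneg_vecs"
    and b_supp: "b \<in> supp a"
    and b_min: "\<And>\<alpha>. \<alpha> \<in> supp a \<Longrightarrow> \<alpha> \<noteq> b \<Longrightarrow> wdot \<gamma> b < wdot \<gamma> \<alpha>"
begin

lemma family_series_powi:
  "family_series \<gamma> b a z = (\<Sum>\<^sub>\<infinity>\<alpha>\<in>nonneg_vecs.
     a \<alpha> * monom_vec (but_last z) \<alpha> * z $ None powi (wdot \<gamma> \<alpha> - wdot \<gamma> b))"
  unfolding family_series_def
proof (rule infsum_cong)
  fix \<alpha> :: "int^'n" assume \<alpha>: "\<alpha> \<in> nonneg_vecs"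
  have "wdot \<gamma> b \<le> wdot \<gamma> \<alpha>" if "a \<alpha> \<noteq> 0"
    using b_min[of \<alpha>] that by (cases "\<alpha> = b") (auto simp: supp_def)
  then show "a \<alpha> * (\<Prod>k\<in>UNIV. z $ k ^ family_exponent \<gamma> b \<alpha> k) =
      a \<alpha> * monom_vec (but_last z) \<alpha> * z $ None powi (wdot \<gamma> \<alpha> - wdot \<gamma> b)"
    by (cases "a \<alpha> = 0")
      (simp_all add: prod_UNIV_option family_exponent_def monom_vec_nat[OF \<alpha>] power_int_def)
qed

lemma family_series_glue:
  assumes t: "z $ None \<noteq> 0"
    and f: "((\<lambda>\<alpha>. a \<alpha> * monom_vec (\<chi> i. z $ None powi (\<gamma> $ i) * z $ Some i) \<alpha>) has_sum f) nonneg_vecs"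
  shows "family_series \<gamma> b a z = z $ None powi (- wdot \<gamma> b) * f"
proof -
  have eq: "(\<chi> i. z $ None powi (\<gamma> $ i) * z $ Some i) = (\<chi> i. z $ None powi (\<gamma> $ i) * but_last z $ i)"
    by simp
  have "family_series \<gamma> b a z = (\<Sum>\<^sub>\<infinity>\<alpha>\<in>nonneg_vecs. z $ None powi (- wdot \<gamma> b) *
      (a \<alpha> * monom_vec (\<chi> i. z $ None powi (\<gamma> $ i) * z $ Some i) \<alpha>))"
    unfolding family_series_powi eq monom_vec_weighted[OF t]
    by (intro infsum_cong) (simp add: t power_int_diff power_int_minus divide_simps)
  also have "\<dots> = z $ None powi (- wdot \<gamma> b) * f"
    using f by (simp add: infsum_cmult_right' infsumI)
  finally show ?thesis .
qed

text \<open>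
  At \<open>t = 0\<close> only terms of least weight survive, and \<open>b\<close> is the unique index of least weight.
\<close>

lemma family_series_zero_fibre:
  assumes "z $ None = 0"
  shows "family_series \<gamma> b a z = a b * (\<Prod>i\<in>UNIV. z $ Some i ^ nat (b $ i))"
proof -
  have bn: "b \<in> nonneg_vecs" using b_supp supp_nonneg by blast
  have "family_series \<gamma> b a z = (\<Sum>\<^sub>\<infinity>\<alpha>\<in>{b}. a \<alpha> * (\<Prod>k\<in>UNIV. z $ k ^ family_exponent \<gamma> b \<alpha> k))"
    unfolding family_series_def
  proof (rule infsum_cong_neutral)
    fix \<alpha> assume "\<alpha> \<in> nonneg_vecs - {b}"
    then have "a \<alpha> = 0 \<or> family_exponent \<gamma> b \<alpha> None > 0"
      using b_min[of \<alpha>] by (auto simp: supp_def family_exponent_def)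
    then show "a \<alpha> * (\<Prod>k\<in>UNIV. z $ k ^ family_exponent \<gamma> b \<alpha> k) = 0"
      using assms by (auto simp: prod_UNIV_option power_0_left)
  qed (use bn in auto)
  then show ?thesis using assms by (simp add: prod_UNIV_option family_exponent_def)
qed

text \<open>
  Weighted homogeneity trades the radius \<open>R\<close> in \<open>w\<close>, however large, for the radius \<open>\<epsilon>\<close> in \<open>t\<close>: as
  \<open>\<gamma> \<cdot> \<alpha> \<ge> \<bar>\<alpha>\<bar>\<close>, every factor \<open>w\<^sub>i\<close> comes with at least one factor \<open>t\<close>. With the doubled radii
  \<open>2 R\<close> and \<open>\<delta> = 2 \<epsilon>\<close> the term of index \<open>\<alpha>\<close> is at most \<open>\<bar>a\<^sub>\<alpha>\<bar> (2 R \<delta>) ^ \<bar>\<alpha>\<bar> / \<delta> ^ B\<close>, where \<open>B = \<gamma> \<cdot> b\<close>, and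
  \<open>2 R \<delta> \<le> \<rho>\<close>.
\<close>

lemma family_series_has_cderiv:
  fixes R \<epsilon> \<rho> :: real
  assumes conv: "(\<lambda>\<alpha>. a \<alpha> * monom_vec (\<chi> i. of_real \<rho>) \<alpha>) summable_on nonneg_vecs"
    and R: "R > 0" and \<epsilon>: "\<epsilon> > 0" "2 * \<epsilon> \<le> 1" "2 * R * (2 * \<epsilon>) \<le> \<rho>"
    and z: "norm (z $ None) < \<epsilon>" "\<And>i. norm (z $ Some i) < R"
  shows "\<exists>D. has_cderiv (family_series \<gamma> b a) D z"
proof -
  define \<delta> where "\<delta> = 2 * \<epsilon>"
  have \<delta>: "\<delta> > 0" "\<delta> \<le> 1" "2 * R * \<delta> \<le> \<rho>" using \<epsilon> by (auto simp: \<delta>_def)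
  define B where "B = nat (wdot \<gamma> b)"
  define r where "r k = (case k of None \<Rightarrow> \<epsilon> | Some i \<Rightarrow> R)" for k :: "'n option"
  have b: "wdot \<gamma> b \<ge> 0" using wdot_nonneg[OF \<gamma>] b_supp supp_nonneg by blast
  have bound: "norm (a \<alpha>) * (\<Prod>k\<in>UNIV. (2 * r k) ^ family_exponent \<gamma> b \<alpha> k)
      \<le> norm (a \<alpha> * monom_vec (\<chi> i. of_real \<rho>) \<alpha>) * (1 / \<delta> ^ B)" if \<alpha>: "\<alpha> \<in> nonneg_vecs" for \<alpha>
  proof (cases "a \<alpha> = 0")
    case False
    define s where "s = (\<Sum>i\<in>UNIV. nat (\<alpha> $ i))"
    define e where "e = nat (wdot \<gamma> \<alpha> - wdot \<gamma> b)"
    have "wdot \<gamma> b \<le> wdot \<gamma> \<alpha>"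
      using b_min[of \<alpha>] False by (cases "\<alpha> = b") (auto simp: supp_def)
    moreover have "int s = (\<Sum>i\<in>UNIV. \<alpha> $ i)"
      using \<alpha> by (simp add: s_def nonneg_vecs_def)
    ultimately have "s \<le> e + B"
      using wdot_nonneg(1)[OF \<gamma> \<alpha>] b unfolding e_def B_def by linarith
    then have "\<delta> ^ e * \<delta> ^ B \<le> \<delta> ^ s"
      using \<delta> by (simp add: power_add[symmetric] power_decreasing)
    then have "\<delta> ^ e \<le> \<delta> ^ s * (1 / \<delta> ^ B)"
      using \<delta> by (simp add: field_simps)
    then have "\<delta> ^ e * (\<Prod>i\<in>UNIV. (2 * R) ^ nat (\<alpha> $ i))
        \<le> (\<delta> ^ s * (1 / \<delta> ^ B)) * (\<Prod>i\<in>UNIV. (2 * R) ^ nat (\<alpha> $ i))"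
      using R by (intro mult_right_mono prod_nonneg) auto
    also have "\<dots> = (\<Prod>i\<in>UNIV. (2 * R * \<delta>) ^ nat (\<alpha> $ i)) * (1 / \<delta> ^ B)"
      unfolding s_def by (simp add: power_mult_distrib prod.distrib power_sum)
    also have "\<dots> \<le> (\<Prod>i\<in>UNIV. \<rho> ^ nat (\<alpha> $ i)) * (1 / \<delta> ^ B)"
      using R \<delta> by (intro mult_right_mono prod_mono conjI power_mono) auto
    also have "(\<Prod>i\<in>UNIV. \<rho> ^ nat (\<alpha> $ i)) = norm (monom_vec (\<chi> i. of_real \<rho> :: complex^'n) \<alpha>)"
      using R \<delta> order.trans[of 0 "2 * R * \<delta>" \<rho>]
      by (simp add: monom_vec_nat[OF \<alpha>] prod_norm[symmetric] norm_power)
    finally have "norm (a \<alpha>) * (\<delta> ^ e * (\<Prod>i\<in>UNIV. (2 * R) ^ nat (\<alpha> $ i)))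
        \<le> norm (a \<alpha>) * (norm (monom_vec (\<chi> i. of_real \<rho> :: complex^'n) \<alpha>) * (1 / \<delta> ^ B))"
      by (intro mult_left_mono) auto
    then show ?thesis
      by (simp only: prod_UNIV_option r_def family_exponent_def e_def \<delta>_def norm_mult mult.assoc option.case)
  qed simp
  show ?thesis
    unfolding family_series_def[abs_def]
  proof (rule power_series_has_cderiv[where r = r])
    show "r k > 0" for k using R \<epsilon> by (auto simp: r_def split: option.split)
    show "norm (z $ k) < r k" for k using z by (auto simp: r_def split: option.split)
    have "(\<lambda>\<alpha>. norm (a \<alpha> * monom_vec (\<chi> i. of_real \<rho>) \<alpha>) * (1 / \<delta> ^ B)) summable_on nonneg_vecs"
      using conv by (intro summable_on_cmult_left) (simp add: summable_on_iff_abs_summable_on_complex)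
    then have "(\<lambda>\<alpha>. norm (norm (a \<alpha>) * (\<Prod>k\<in>UNIV. (2 * r k) ^ family_exponent \<gamma> b \<alpha> k))) summable_on nonneg_vecs"
      by (rule Infinite_Sum.abs_summable_on_comparison_test')
        (use bound R \<epsilon> in \<open>auto simp: abs_mult abs_prod power_abs r_def intro!: prod.cong split: option.split\<close>)
    then show "(\<lambda>\<alpha>. norm (a \<alpha>) * (\<Prod>k\<in>UNIV. (2 * r k) ^ family_exponent \<gamma> b \<alpha> k)) summable_on nonneg_vecs"
      by (rule Infinite_Sum.abs_summable_summable)
  qed
qed

text \<open>
  In directions tangent to the zero fibre the series may be replaced by its restriction to the
  fibre, a monomial with exponent \<open>b\<close>, whose logarithmic derivative is the linear form
  \<open>\<Sum>i. b\<^sub>i h\<^sub>i / w\<^sub>i\<close>.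
\<close>

lemma family_series_deriv_zero_fibre:
  assumes z: "z $ None = 0" "\<And>i. z $ Some i \<noteq> 0" and h: "h $ None = 0"
    and D: "has_cderiv (family_series \<gamma> b a) D z"
  shows "D h = family_series \<gamma> b a z * (\<Sum>i\<in>UNIV. of_int (b $ i) * (h $ Some i / z $ Some i))"
proof -
  define P :: "complex^('n option) \<Rightarrow> complex^('n option)" where "P y = with_last (but_last y) 0" for y
  have P: "P y $ None = 0" "P y $ Some i = y $ Some i" for y i by (simp_all add: P_def)
  have Peq: "P y = y" if "y $ None = 0" for y
    using that by (intro vec_option_eqI) (simp_all add: P vec_eq_iff)
  have blP: "bounded_linear P"
    by (intro linear_linear[THEN iffD2] linearI) (auto simp: vec_eq_iff P_def split_option_all)
  have "has_cderiv (\<lambda>y. family_series \<gamma> b a (P y)) (\<lambda>h. D (P h)) z"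
  proof (rule has_cderiv_matrix_comp)
    show "has_cderiv (family_series \<gamma> b a) D (P z)" using D by (simp only: Peq[OF z(1)])
    show "P (s *s h) = s *s P h" for s h by (simp add: vec_eq_iff P split_option_all)
  qed (rule blP)
  moreover have "(\<lambda>y. family_series \<gamma> b a (P y)) = (\<lambda>y. a b * (\<Prod>i\<in>UNIV. y $ Some i ^ nat (b $ i)))"
    by (simp add: family_series_zero_fibre P)
  moreover have "((\<lambda>y :: complex^('n option). a b * (\<Prod>i\<in>UNIV. y $ Some i ^ nat (b $ i))) has_derivative
      (\<lambda>h. a b * (\<Sum>i\<in>UNIV. of_nat (nat (b $ i)) * h $ Some i * z $ Some i ^ (nat (b $ i) - 1)
        * (\<Prod>k\<in>UNIV - {i}. z $ Some k ^ nat (b $ k))))) (at z)"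
    by (rule has_derivative_eq_rhs, (rule derivative_intros bounded_linear.has_derivative[OF bounded_linear_vec_nth])+)
      (auto simp: fun_eq_iff algebra_simps)
  ultimately have "D (P h) = a b * (\<Sum>i\<in>UNIV. of_nat (nat (b $ i)) * h $ Some i * z $ Some i ^ (nat (b $ i) - 1)
        * (\<Prod>k\<in>UNIV - {i}. z $ Some k ^ nat (b $ k)))"
    unfolding has_cderiv_def by (metis (no_types, lifting) has_derivative_unique)
  also have "(\<Sum>i\<in>UNIV. of_nat (nat (b $ i)) * h $ Some i * z $ Some i ^ (nat (b $ i) - 1)
        * (\<Prod>k\<in>UNIV - {i}. z $ Some k ^ nat (b $ k)))
      = (\<Sum>i\<in>UNIV. (\<Prod>k\<in>UNIV. z $ Some k ^ nat (b $ k)) * (of_int (b $ i) * (h $ Some i / z $ Some i)))"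
  proof (rule sum.cong[OF refl])
    fix i :: 'n
    have "b $ i \<ge> 0" using b_supp supp_nonneg by (auto simp: nonneg_vecs_def)
    then obtain n where n: "b $ i = int n" by (metis nonneg_int_cases)
    have "of_nat n * h $ Some i * z $ Some i ^ (n - 1) = z $ Some i ^ n * (of_nat n * (h $ Some i / z $ Some i))"
      using z(2) by (cases n) auto
    then show "of_nat (nat (b $ i)) * h $ Some i * z $ Some i ^ (nat (b $ i) - 1)
        * (\<Prod>k\<in>UNIV - {i}. z $ Some k ^ nat (b $ k))
      = (\<Prod>k\<in>UNIV. z $ Some k ^ nat (b $ k)) * (of_int (b $ i) * (h $ Some i / z $ Some i))"
      using n by (subst prod.remove[of UNIV i]) simp_all
  qed
  finally show ?thesis
    by (simp add: Peq[OF h] family_series_zero_fibre[OF z(1)] sum_distrib_left mult.assoc)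
qed

end

section \<open>The immersion property along the zero fibre\<close>

text \<open>
  On the zero fibre the homogeneous coordinates are monomials \<open>G\<^sub>j\<close> with exponents \<open>\<beta>\<^sub>j\<close> and nonzero
  coefficients. The relation \<open>dG (h) = \<lambda> G\<close> says that the linear form with coefficients \<open>h\<^sub>i / w\<^sub>i\<close> has
  the same value \<open>\<lambda>\<close> at all \<open>\<beta>\<^sub>j\<close>, so \<open>h = 0\<close> because the differences generate the lattice.

  Near the fibre the vector \<open>G\<close> must still represent the map that is defined by the sections. It does:
  a nearby point with \<open>t \<noteq> 0\<close> is glued to some \<open>(x, t)\<close> with \<open>x\<close> close to \<open>p\<close>, and there \<open>G\<close> differs from
  the coordinates given by the sections by the factor \<open>\<tau> x\<close>.
\<close>

lemma family_map_immersive_zero_fibre: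
  fixes X U :: "'m::finite cproj set" and u :: "'m cproj \<Rightarrow> complex^'n::finite"
    and \<eta> :: "'r::finite \<Rightarrow> ('i, 'm) lsection" and w :: "complex^'n"
  assumes U: "openin (top_of_set X) U" "p \<in> U" "biholomorphic_on X U u" and p: "u p = 0"
    and c: "\<And>j. power_series_at X u p (squot T (\<eta> j) \<tau>) (c j)"
    and \<gamma>: "\<And>i. \<gamma> $ i > 0"
    and \<beta>: "\<And>j. \<beta> j \<in> supp (c j) \<and> (\<forall>\<alpha>\<in>supp (c j). \<alpha> \<noteq> \<beta> j \<longrightarrow> wdot \<gamma> (\<beta> j) < wdot \<gamma> \<alpha>)"
    and gen: "differences_generate (range \<beta>)"
    and w: "\<And>i. w $ i \<noteq> 0"
  shows "holo_with_rank_at (family_params X U u \<gamma>) cproj_times_line_charts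
    (family_map T \<gamma> \<eta> \<beta> c) (glue_rel X U u \<gamma> `` {Inr (with_last w 0)}) CARD('n option)"
proof -
  have UX: "U \<subseteq> X" using openin_subset[OF U(1)] by simp
  have inj: "inj_on u U" using U(3) by (simp add: biholomorphic_on_def)
  have ws: "weighted_series \<gamma> (\<beta> j) (c j)" for j
    using \<gamma> c[of j] \<beta>[of j] by (simp add: weighted_series_def power_series_at_def)
  obtain \<rho> where \<rho>: "\<rho> > 0" and series: "\<forall>y. (\<forall>i. norm (y $ i) \<le> \<rho>) \<longrightarrow> (\<exists>x\<in>U. u x = y \<and>
      (\<forall>j. ((\<lambda>\<alpha>. c j \<alpha> * monom_vec y \<alpha>) has_sum squot T (\<eta> j) \<tau> x) nonneg_vecs))"
    by (rule power_series_neighbourhood[where f = "\<lambda>j. squot T (\<eta> j) \<tau>" and c = c, OF U p c])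
  have conv: "(\<lambda>\<alpha>. c j \<alpha> * monom_vec (\<chi> i. of_real \<rho>) \<alpha>) summable_on nonneg_vecs" for j
    using series[rule_format, of "\<chi> i. of_real \<rho>"] \<rho> by (auto simp: summable_on_def)
  define R where "R = 1 + norm w"
  \<comment> \<open>\<open>R\<close> makes room around \<open>w\<close>; \<open>\<epsilon>\<close> is then so small that \<open>t\<^sup>\<gamma> w\<close> stays in the polydisc of radius \<open>\<rho>\<close>.\<close>
  define \<epsilon> where "\<epsilon> = min 1 (\<rho> / (2 * R)) / 2"
  have R: "R > 0" unfolding R_def by (simp add: add_pos_nonneg)
  have \<epsilon>: "\<epsilon> > 0" "2 * \<epsilon> \<le> 1" "2 * R * (2 * \<epsilon>) \<le> \<rho>"
  proof -
    show "\<epsilon> > 0" "2 * \<epsilon> \<le> 1" using R \<rho> by (auto simp: \<epsilon>_def)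
    have "2 * \<epsilon> \<le> \<rho> / (2 * R)" by (simp add: \<epsilon>_def)
    then show "2 * R * (2 * \<epsilon>) \<le> \<rho>" using R by (simp add: field_simps)
  qed
  define G where "G z = (\<chi> j. family_series \<gamma> (\<beta> j) (c j) z)" for z
  define S0 where "S0 = {z :: complex^('n option). norm (z $ None) < \<epsilon> \<and> (\<forall>i. norm (z $ Some i) < R \<and> z $ Some i \<noteq> 0)}"
  have "open S0"
  proof -
    have "open ({z :: complex^('n option). norm (z $ None) < \<epsilon>} \<inter>
        (\<Inter>i. {z. norm (z $ Some i) < R} \<inter> {z. z $ Some i \<noteq> 0}))"
      by (intro open_Int open_INT ballI finite open_Collect_less open_Collect_neq continuous_intros)
    also have "\<dots> = S0" by (auto simp: S0_def)
    finally show ?thesis .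
  qed
  have G: "\<exists>D. has_cderiv (\<lambda>z. G z $ j) D z" if "z \<in> S0" for z j
    using weighted_series.family_series_has_cderiv[OF ws conv R \<epsilon>] that
    by (simp add: G_def S0_def)
  have "continuous_on S0 G"
    by (rule has_cderiv_continuous_on[OF G])
  define S where "S = S0 \<inter> G -` (- {0})"
  have "open S"
    unfolding S_def using \<open>continuous_on S0 G\<close> \<open>open S0\<close> by (intro continuous_open_preimage) auto
  have glue: "z \<in> glue_chart U u \<gamma> \<and>
      family_map T \<gamma> \<eta> \<beta> c (glue_rel X U u \<gamma> `` {Inr z}) = (pt (G z), z $ None)"
    if z: "z \<in> S" for z
  proof (cases "z $ None = 0")
    case True
    have "z = with_last (but_last z) 0"
      using True by (intro vec_option_eqI) (simp_all add: vec_eq_iff)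
    moreover have "\<forall>i. but_last z $ i \<noteq> 0" using z by (simp add: S_def S0_def)
    ultimately have "z \<in> glue_chart U u \<gamma>" unfolding glue_chart_def by blast
    with True show ?thesis
      by (simp add: family_map_zero_fibre G_def weighted_series.family_series_powi[OF ws])
  next
    case False
    define t where "t = z $ None"
    define y where "y = (\<chi> i. t powi (\<gamma> $ i) * z $ Some i)"
    have t: "t \<noteq> 0" "norm t < \<epsilon>" using z False by (auto simp: t_def S_def S0_def)
    have "norm (y $ i) \<le> \<rho>" for i
    proof -
      have "norm t powi (\<gamma> $ i) \<le> norm t powi 1"
        using \<gamma>[of i] t(2) \<epsilon>(2) power_decreasing[of 1 "nat (\<gamma> $ i)" "norm t"]
        by (simp add: power_int_def)
      then have "norm (y $ i) \<le> norm t * norm (z $ Some i)"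
        unfolding y_def by (simp add: norm_mult norm_power_int mult_right_mono)
      also have "\<dots> \<le> \<epsilon> * R"
        using z t \<epsilon> by (intro mult_mono) (auto simp: S_def S0_def less_imp_le)
      also have "\<dots> \<le> \<rho>" using \<epsilon>(3) mult_pos_pos[OF \<epsilon>(1) R] by (simp add: mult.commute)
      finally show ?thesis .
    qed
    then obtain x where x: "x \<in> U" "u x = y"
      and fx: "\<And>j. ((\<lambda>\<alpha>. c j \<alpha> * monom_vec y \<alpha>) has_sum squot T (\<eta> j) \<tau> x) nonneg_vecs"
      using series by blast
    have zx: "z = glue_map u \<gamma> (x, t)"
      using t x(2) by (auto simp: vec_eq_iff split_option_all y_def t_def power_int_minus)
    have Gj: "G z $ j = t powi (- wdot \<gamma> (\<beta> j)) * squot T (\<eta> j) \<tau> x" for j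
      using weighted_series.family_series_glue[OF ws, of z] fx[of j] t by (simp add: G_def y_def t_def)
    have "G z \<noteq> 0" using z by (simp add: S_def)
    \<comment> \<open>If \<open>\<tau>\<close> vanished at \<open>x\<close>, all quotients would take the default value \<open>0\<close>, and so would \<open>G\<close>.\<close>
    have \<tau>: "sval T \<tau> x \<noteq> 0"
    proof
      assume "sval T \<tau> x = 0"
      then have "G z = 0" by (simp add: vec_eq_iff Gj squot_def)
      with \<open>G z \<noteq> 0\<close> show False by simp
    qed
    have "glue_rel X U u \<gamma> `` {Inr z} = glue_rel X U u \<gamma> `` {Inl (x, t)}"
      unfolding zx using x t by (intro glue_class_Inr[OF UX inj]) auto
    then have "family_map T \<gamma> \<eta> \<beta> c (glue_rel X U u \<gamma> `` {Inr z}) =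
        (pt (\<chi> j. t powi (- wdot \<gamma> (\<beta> j)) * sval T (\<eta> j) x), t)"
      using x t UX by (simp add: family_map_general subset_iff)
    also have "(\<chi> j. t powi (- wdot \<gamma> (\<beta> j)) * sval T (\<eta> j) x) = sval T \<tau> x *s G z"
      using \<tau> by (simp add: vec_eq_iff Gj squot_def)
    also have "pt (sval T \<tau> x *s G z) = pt (G z)"
      using \<open>G z \<noteq> 0\<close> \<tau> by (rule pt_scale)
    finally have "family_map T \<gamma> \<eta> \<beta> c (glue_rel X U u \<gamma> `` {Inr z}) = (pt (G z), z $ None)"
      by (simp only: t_def)
    moreover have "z \<in> glue_chart U u \<gamma>"
      unfolding zx glue_chart_def using x(1) t(1) by blast
    ultimately show ?thesis by blast
  qed
  define z0 where "z0 = with_last w 0"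
  have z0: "z0 $ None = 0" "\<And>i. z0 $ Some i \<noteq> 0" using w by (auto simp: z0_def)
  have Gz0: "G z0 $ j \<noteq> 0" for j
    using \<beta>[of j] z0 by (simp add: G_def weighted_series.family_series_zero_fibre[OF ws z0(1)] supp_def)
  have "norm (w $ i) < R" for i
    using Finite_Cartesian_Product.norm_nth_le[of w i] by (simp add: R_def)
  then have z0S0: "z0 \<in> S0" using w \<epsilon> by (simp add: S0_def z0_def)
  have Gz0': "G z0 \<noteq> 0" using Gz0[of undefined] by auto
  obtain D where D: "\<And>j. has_cderiv (\<lambda>z. G z $ j) (D j) z0"
    using G[OF z0S0] by metis
  have "holo_with_rank_at (family_params X U u \<gamma>) cproj_times_line_charts
    (family_map T \<gamma> \<eta> \<beta> c) ((\<lambda>z. glue_rel X U u \<gamma> `` {Inr z}) z0) CARD('n option)"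
  proof (rule holo_with_rank_at_homogeneousI[where W = "glue_chart U u \<gamma>" and S = S and G = G])
    show "(glue_chart U u \<gamma>, \<lambda>z. glue_rel X U u \<gamma> `` {Inr z}) \<in> family_params X U u \<gamma>"
      by (simp add: family_params_def)
    show "open S" by fact
    show "z0 \<in> S" using z0S0 Gz0' by (simp add: S_def)
    show "S \<subseteq> glue_chart U u \<gamma>" using glue by blast
    show "family_map T \<gamma> \<eta> \<beta> c (glue_rel X U u \<gamma> `` {Inr z}) = (pt (G z), z $ None)" if "z \<in> S" for z
      using glue[OF that] by blast
    show "\<exists>D. has_cderiv (\<lambda>z. G z $ j) D z" if "z \<in> S" for z j
      using that by (intro G) (simp add: S_def)
    show "has_cderiv (\<lambda>z. G z $ j) (D j) z0" for j by (rule D)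
    show "G z0 \<noteq> 0" by (rule Gz0')
    show "h = 0" if h: "h $ None = 0" and l: "\<And>j. D j h = l * G z0 $ j" for h l
    proof -
      have "(\<Sum>i\<in>UNIV. of_int (\<beta> j $ i) * (h $ Some i / z0 $ Some i)) = l" for j
      proof -
        have "D j h = G z0 $ j * (\<Sum>i\<in>UNIV. of_int (\<beta> j $ i) * (h $ Some i / z0 $ Some i))"
          using weighted_series.family_series_deriv_zero_fibre[OF ws z0 h] D[of j] by (simp add: G_def)
        with l[of j] Gz0[of j] show ?thesis by simp
      qed
      then have "h $ Some i / z0 $ Some i = 0" for i
        by (intro differences_generate_separates[OF gen]) auto
      then have "h $ Some i = 0" for i using z0(2)[of i] by (metis divide_eq_0_iff)
      with h show ?thesis by (simp add: vec_eq_iff split_option_all)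
    qed
  qed
  then show ?thesis by (simp add: z0_def)
qed

section \<open>The immersion theorem\<close>

theorem theorem6p2:
  fixes X U :: "'m::finite cproj set"
    and T :: "'i \<Rightarrow> 'm cproj set" and g :: "'i \<Rightarrow> 'i \<Rightarrow> 'm cproj \<Rightarrow> complex"
    and E :: "('i, 'm) lsection set"
    and H :: "(('i, 'm) lsection \<Rightarrow> complex) \<Rightarrow> (('i, 'm) lsection \<Rightarrow> complex) \<Rightarrow> complex"
    and Par :: "('n::finite, 'm cproj) params"
    and p :: "'m cproj" and u :: "'m cproj \<Rightarrow> complex^'n"
    and le :: "int^'n \<Rightarrow> int^'n \<Rightarrow> bool"
    and \<tau> :: "('i, 'm) lsection" and \<eta> :: "'r::finite \<Rightarrow> ('i, 'm) lsection"
    and c :: "'r \<Rightarrow> int^'n \<Rightarrow> complex" and \<beta> :: "'r \<Rightarrow> int^'n" and \<gamma> :: "int^'n"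
  assumes "smooth_projective_variety X CARD('n)"
    and "Par = local_params X"
    and "line_bundle Par X T g"
    and "E \<subseteq> holomorphic_sections Par T g" and "sec.subspace E"
    and "kodaira_embedding TYPE('r) Par X T E"
    and "hermitian_product (dual_space E) H"
    and "p \<in> X" and "coordinate_system X p u"
    and "admissible_order le"
    and "\<tau> \<in> E" and "sval T \<tau> p \<noteq> 0"
    and "basis_of E \<eta>"
    and "\<And>i j. H (dual_basis \<eta> i) (dual_basis \<eta> j) = (if i = j then 1 else 0)"
    and "range (\<lambda>j. valuation X u p le (squot T (\<eta> j) \<tau>)) = value_set X u p le T E \<tau>"
    and "\<And>j. power_series_at X u p (squot T (\<eta> j) \<tau>) (c j)"
    and "\<And>j. \<beta> j = valuation X u p le (squot T (\<eta> j) \<tau>)"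
    and "\<And>i. \<gamma>$i > 0"
    and "\<And>j. \<beta> j \<in> supp (c j) \<and> (\<forall>\<alpha>\<in>supp (c j). \<alpha> \<noteq> \<beta> j \<longrightarrow> wdot \<gamma> (\<beta> j) < wdot \<gamma> \<alpha>)"
    and "differences_generate (value_set X u p le T E \<tau>)"
    and "openin (top_of_set X) U" and "p \<in> U" and "biholomorphic_on X U u"
  shows "holomorphic_immersion (family_params X U u \<gamma>) cproj_times_line_charts
           (family X U u \<gamma>) (family_map T \<gamma> \<eta> \<beta> c)"
  unfolding holomorphic_immersion_def
proof
  note kodaira = \<open>kodaira_embedding TYPE('r) Par X T E\<close>[unfolded \<open>Par = local_params X\<close>]
  have UX: "U \<subseteq> X" using openin_subset[OF \<open>openin (top_of_set X) U\<close>] by simp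
  have inj: "inj_on u U" using \<open>biholomorphic_on X U u\<close> by (simp add: biholomorphic_on_def)
  have p: "u p = 0" using \<open>coordinate_system X p u\<close> by (simp add: coordinate_system_def)
  have "range \<beta> = value_set X u p le T E \<tau>"
    using \<open>range (\<lambda>j. valuation X u p le (squot T (\<eta> j) \<tau>)) = value_set X u p le T E \<tau>\<close>
      \<open>\<And>j. \<beta> j = valuation X u p le (squot T (\<eta> j) \<tau>)\<close> by simp
  with \<open>differences_generate (value_set X u p le T E \<tau>)\<close>
  have gen: "differences_generate (range \<beta>)" by simp
  fix q assume "q \<in> family X U u \<gamma>"
  then show "holo_with_rank_at (family_params X U u \<gamma>) cproj_times_line_charts
    (family_map T \<gamma> \<eta> \<beta> c) q CARD('n option)"
    using UX inj
  proof (cases rule: family_cases)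
    case (general x t)
    then show ?thesis
      using family_map_immersive_general[OF kodaira \<open>basis_of E \<eta>\<close>] by simp
  next
    case (zero_fibre w)
    show ?thesis
      unfolding zero_fibre(2)
      by (rule family_map_immersive_zero_fibre) (fact | rule p gen zero_fibre(1))+
  qed
qed

end
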